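(* Let $Q$ be an interval, $C\ge1$, $\xi^\pm=\xi^\pm(C)$, and let $\varphi$ be such that $e^\varphi\in A_\infty^C(Q)$. Then for any $\lambda\in\mathbb R$ and any subinterval $J$ of $Q$, $$\frac1{|J|}\,\big|\{t\in J:~\varphi(t)-\langle\varphi\rangle_J\ge\lambda\}\big|\le \begin{cases} 1,& \lambda\le 0,\\[4pt] 1-\dfrac{\lambda}{\xi^+-\xi^-},& 0\le \lambda \le -\xi^-,\\[8pt] \dfrac{\xi^+e^{-\xi^-/\xi^+}}{\xi^+-\xi^-}\,e^{-\lambda/\xi^+},& \lambda\ge -\xi^-. \end{cases}$$ (For $C=1$ the right-hand side is understood as $1$ for $\lambda\le0$ and $0$ for $\lambda>0$.) This inequality is sharp for each value of $\lambda$, i.e., for each $C\ge1$ and $\lambda\in\mathbb R$ the right-hand side cannot be replaced by a smaller number depending only on $C$ and $\lambda$.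
   Context: For an interval $J$, $\langle\varphi\rangle_J=\frac1{|J|}\int_J\varphi$. An a.e. positive function $w$ is in $A_\infty(Q)$ if $w$ and $\log w$ are locally integrable and $[w]_{A_\infty(Q)}:=\sup_{J\subset Q}\langle w\rangle_Je^{-\langle\log w\rangle_J}<\infty$, the supremum being over all subintervals $J$ of the interval $Q$. For $C\ge1$, $A_\infty^C(Q)=\{w\in A_\infty(Q):[w]_{A_\infty(Q)}\le C\}$. For $C\ge1$, $\xi^\pm=\xi^\pm(C)$ are the two solutions of $e^{-\xi}=C(1-\xi)$ with $-\infty<\xi^-\le0\le\xi^+<1$ (both are $0$ when $C=1$). *)

theory Defs
  imports "HOL-Analysis.Analysis"
begin

text \<open>Intervals may be open, closed, half-open or unbounded, but never reduce to a point.\<close>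

definition nondegenerate_interval :: "real set \<Rightarrow> bool" where
  "nondegenerate_interval Q \<longleftrightarrow> is_interval Q \<and> interior Q \<noteq> {}"

text \<open>The subintervals over which averages are taken: they have finite positive length.\<close>

definition subintervals :: "real set \<Rightarrow> real set set" where
  "subintervals Q = {J. J \<subseteq> Q \<and> nondegenerate_interval J \<and> bounded J}"

definition average :: "real set \<Rightarrow> (real \<Rightarrow> real) \<Rightarrow> real" where
  "average J f = (LINT t:J|lebesgue. f t) / measure lebesgue J"

definition A_inf_char :: "real set \<Rightarrow> (real \<Rightarrow> real) \<Rightarrow> ereal" where
  "A_inf_char Q w =
     (SUP J\<in>subintervals Q. ereal (average J w * exp (- average J (\<lambda>t. ln (w t)))))"

text \<open>Integrability is required on every bounded subinterval, including those whose closure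
  is not contained in \<open>Q\<close>, so that every average entering the supremum is a genuine finite
  integral rather than the default value \<open>0\<close> of a non-integrable function.\<close>

definition A_inf :: "real set \<Rightarrow> (real \<Rightarrow> real) set" where
  "A_inf Q = {w. (AE t in lebesgue. t \<in> Q \<longrightarrow> 0 < w t)
     \<and> (\<forall>J\<in>subintervals Q. set_integrable lebesgue J w
          \<and> set_integrable lebesgue J (\<lambda>t. ln (w t)))
     \<and> A_inf_char Q w < \<infinity>}"

definition A_inf_le :: "real \<Rightarrow> real set \<Rightarrow> (real \<Rightarrow> real) set" where
  "A_inf_le C Q = {w \<in> A_inf Q. A_inf_char Q w \<le> ereal C}"

definition xi_plus :: "real \<Rightarrow> real" where
  "xi_plus C = (THE \<xi>. 0 \<le> \<xi> \<and> \<xi> < 1 \<and> exp (- \<xi>) = C * (1 - \<xi>))"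

definition xi_minus :: "real \<Rightarrow> real" where
  "xi_minus C = (THE \<xi>. \<xi> \<le> 0 \<and> exp (- \<xi>) = C * (1 - \<xi>))"

text \<open>The separate branch for \<open>C = 1\<close> is needed because then \<open>xi_plus C = xi_minus C = 0\<close>.\<close>

definition tail_bound :: "real \<Rightarrow> real \<Rightarrow> real" where
  "tail_bound C lam =
     (if lam \<le> 0 then 1
      else if C = 1 then 0
      else if lam \<le> - xi_minus C then 1 - lam / (xi_plus C - xi_minus C)
      else xi_plus C * exp (- xi_minus C / xi_plus C) / (xi_plus C - xi_minus C)
             * exp (- lam / xi_plus C))"

lemma xi_ratio_deriv:
  fixes x :: real
  assumes "x < 1"
  shows "((\<lambda>x. exp (- x) / (1 - x)) has_real_derivative x * exp (- x) / (1 - x)\<^sup>2) (at x)"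
  using assms
  by (auto intro!: derivative_eq_intros simp: field_simps power2_eq_square)

lemma xi_plus_ex1:
  assumes "1 \<le> C"
  shows "\<exists>!\<xi>::real. 0 \<le> \<xi> \<and> \<xi> < 1 \<and> exp (- \<xi>) = C * (1 - \<xi>)"
proof -
  have "\<exists>x\<ge>0. x \<le> 1 \<and> exp (- x) - C * (1 - x) = (0::real)"
    by (rule IVT') (use assms in \<open>auto intro!: continuous_intros\<close>)
  then obtain x :: real where x: "0 \<le> x" "x \<le> 1" "exp (- x) = C * (1 - x)" by auto
  have "x \<noteq> 1"
  proof
    assume "x = 1"
    with x(3) have "exp (- 1 :: real) = 0" by simp
    then show False by simp
  qed
  have False if ab: "0 \<le> a" "a < b" "b < 1" "exp (- a) = C * (1 - a)" "exp (- b) = C * (1 - b)"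
    for a b :: real
  proof -
    have "exp (- a) / (1 - a) < exp (- b) / (1 - b)"
    proof (rule DERIV_pos_imp_increasing_open[OF ab(2)])
      fix y assume "a < y" "y < b"
      then show "\<exists>d. ((\<lambda>x. exp (- x) / (1 - x)) has_real_derivative d) (at y) \<and> d > 0"
        using ab by (intro exI[of _ "y * exp (- y) / (1 - y)\<^sup>2"] conjI xi_ratio_deriv) auto
    next
      show "continuous_on {a..b} (\<lambda>x. exp (- x) / (1 - x))"
        using ab by (intro continuous_intros) auto
    qed
    with ab show False by simp
  qed
  with x \<open>x \<noteq> 1\<close> show ?thesis
    by (intro ex1I[of _ x]) (auto, metis linorder_neqE_linordered_idom order_le_less)
qed

lemma xi_minus_ex1:
  assumes "1 \<le> C"
  shows "\<exists>!\<xi>::real. \<xi> \<le> 0 \<and> exp (- \<xi>) = C * (1 - \<xi>)"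
proof -
  have e: "exp (2 * C) \<ge> C * (1 + 2 * C)"
    using exp_lower_Taylor_quadratic[of "2 * C"] assms by (simp add: algebra_simps power2_eq_square)
  have "\<exists>x\<ge>- 2 * C. x \<le> 0 \<and> exp (- x) - C * (1 - x) = (0::real)"
    by (rule IVT2') (use assms e in \<open>auto intro!: continuous_intros\<close>)
  then obtain x :: real where x: "x \<le> 0" "exp (- x) = C * (1 - x)" by auto
  have False if ab: "a < b" "b \<le> 0" "exp (- a) = C * (1 - a)" "exp (- b) = C * (1 - b)"
    for a b :: real
  proof -
    have "exp (- a) / (1 - a) > exp (- b) / (1 - b)"
    proof (rule DERIV_neg_imp_decreasing_open[OF ab(1)])
      fix y assume "a < y" "y < b"
      then show "\<exists>d. ((\<lambda>x. exp (- x) / (1 - x)) has_real_derivative d) (at y) \<and> d < 0"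
        using ab
        by (intro exI[of _ "y * exp (- y) / (1 - y)\<^sup>2"] conjI xi_ratio_deriv)
          (auto intro!: divide_neg_pos mult_neg_pos)
    next
      show "continuous_on {a..b} (\<lambda>x. exp (- x) / (1 - x))"
        using ab by (intro continuous_intros) auto
    qed
    with ab show False by simp
  qed
  with x show ?thesis
    by (intro ex1I[of _ x]) (auto, metis linorder_neqE_linordered_idom)
qed

end

theory Submission
  imports Defs
begin

text \<open>
  Write \<open>x\<close> and \<open>- y\<close> for the two roots. The convex function \<open>e\<^sup>p\<close> minus its tangent at
  \<open>m - x\<close> is nonnegative, so Chebyshev's inequality on an interval with average \<open>m\<close> bounds the
  proportion of \<open>{\<phi> \<ge> m + y}\<close> by \<open>x / (x + y)\<close>. For \<open>\<lambda> \<ge> y\<close> this is iterated: by the rising sun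
  lemma the part of an interval of average \<open>m\<close> where \<open>\<phi> > m + \<delta>\<close> is covered by disjoint intervals
  of average exactly \<open>m + \<delta>\<close>, and passing from the tangent at level \<open>m\<close> to the one at level
  \<open>m + \<delta>\<close> costs the factor \<open>e\<close> to the power \<open>- (1/x - 1) \<delta>\<close> up to an error \<open>o(\<delta>)\<close>; letting
  \<open>\<delta>\<close> tend to \<open>0\<close> gives the exponential decay. For \<open>0 < \<lambda> < y\<close> one first truncates \<open>\<phi>\<close> from above
  at the level in question, which does not increase the characteristic of any interval, and then
  selects the intervals on which the average equals that level minus \<open>y\<close>.

  Equality holds for a function on the half line that takes the values \<open>y\<close> and \<open>- x\<close> on \<open>(0, 1)\<close>
  and continues as \<open>- x (1 + ln t)\<close>.
\<close>

section \<open>Integral inequalities by the rising sun lemma\<close>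

text \<open>\<open>K\<close> is covered by finitely many cells \<open>[p, q]\<close> of length at most \<open>\<delta>\<close> with end points in \<open>K\<close>;
  consecutive cells are separated by gaps of \<open>K\<close>, and the cells shrink to \<open>K\<close> as \<open>\<delta>\<close> tends to \<open>0\<close>.\<close>

lemma integral_compact_le_of_gaps:
  fixes f \<Psi> :: "real \<Rightarrow> real" and K :: "real set"
  assumes K: "compact K" "a \<in> K" "b \<in> K" "K \<subseteq> {a..b}"
    and f: "f absolutely_integrable_on {a..b}"
    and gap: "\<And>p q. \<lbrakk>p \<in> K; q \<in> K; p < q; {p<..<q} \<inter> K = {}\<rbrakk> \<Longrightarrow> \<Psi> p \<le> \<Psi> q"
    and cell: "\<And>p q. \<lbrakk>p \<in> K; q \<in> K; p \<le> q\<rbrakk> \<Longrightarrow> integral {p..q} f \<le> \<Psi> q - \<Psi> p"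
  shows "integral K f \<le> \<Psi> b - \<Psi> a"
proof -
  have fS: "f absolutely_integrable_on S" if "S \<in> sets lebesgue" "S \<subseteq> {a..b}" for S
    using set_integrable_subset[OF f] that by auto
  \<comment> \<open>The number \<open>n\<close> counts steps of length \<delta> still needed to
    reach \<open>b\<close> from \<open>p\<close>; the induction builds the union \<open>W\<close> of
    cells from left to right.\<close>
  have step: "\<exists>W\<in>sets lebesgue. K \<inter> {p..b} \<subseteq> W \<and> W \<subseteq> {p..b} \<and> (\<forall>t\<in>W. \<exists>k\<in>K. \<bar>t - k\<bar> \<le> \<delta>)
      \<and> integral W f \<le> \<Psi> b - \<Psi> p"
    if "0 < \<delta>" "p \<in> K" "b - p \<le> real n * \<delta>" for \<delta> p n
    using that
  proof (induction n arbitrary: p)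
    case 0
    then have "p = b" using K by auto
    have "integral {b} f = 0"
      using integral_refl[of b f] by simp
    then show ?case using \<open>p = b\<close> K(3) \<open>0 < \<delta>\<close> by (intro bexI[of _ "{b}"]) (auto intro!: bexI[of _ b])
  next
    case (Suc n)
    \<comment> \<open>The cell is [p, q] with \<open>q\<close> the last point of \<open>K\<close> in
      reach of \<open>p\<close>. The first point \<open>p'\<close> of \<open>K\<close> from p +
      \<delta> on is at least \<delta> further, which uses up one step, and (q, p') contains no
      point of \<open>K\<close>, so \<open>gap\<close> applies.\<close>
    define q where "q = Sup (K \<inter> {p..p + \<delta>})"
    have cq: "compact (K \<inter> {p..p + \<delta>})" using K by (intro compact_Int) auto
    have neq: "p \<in> K \<inter> {p..p + \<delta>}" using Suc.prems by auto
    have q: "q \<in> K \<inter> {p..p + \<delta>}"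
      unfolding q_def by (rule closed_contains_Sup) (use cq neq in \<open>auto intro: compact_imp_closed compact_imp_bounded bounded_imp_bdd_above\<close>)
    have qmax: "t \<le> q" if "t \<in> K" "p \<le> t" "t \<le> p + \<delta>" for t
      unfolding q_def by (rule cSup_upper) (use that cq in \<open>auto intro: compact_imp_bounded bounded_imp_bdd_above\<close>)
    show ?case
    proof (cases "b \<le> p + \<delta>")
      case True
      show ?thesis
        using cell[of p b] Suc.prems K True by (intro bexI[of _ "{p..b}"]) force+
    next
      case False
      define p' where "p' = Inf (K \<inter> {p + \<delta>..b})"
      have cp: "compact (K \<inter> {p + \<delta>..b})" using K by (intro compact_Int) auto
      have p': "p' \<in> K \<inter> {p + \<delta>..b}"
        unfolding p'_def by (rule closed_contains_Inf) (use cp False K in \<open>auto intro: compact_imp_closed compact_imp_bounded bounded_imp_bdd_below\<close>)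
      have pmin: "p' \<le> t" if "t \<in> K" "p + \<delta> \<le> t" "t \<le> b" for t
        unfolding p'_def by (rule cInf_lower) (use that cp in \<open>auto intro: compact_imp_bounded bounded_imp_bdd_below\<close>)
      have "b - p' \<le> real n * \<delta>" using Suc.prems p' by (auto simp: algebra_simps)
      then obtain W where W: "W \<in> sets lebesgue" "K \<inter> {p'..b} \<subseteq> W" "W \<subseteq> {p'..b}"
        "\<forall>t\<in>W. \<exists>k\<in>K. \<bar>t - k\<bar> \<le> \<delta>" "integral W f \<le> \<Psi> b - \<Psi> p'"
        using Suc.IH[of p'] Suc.prems p' by auto
      have qp': "q \<le> p'" using q p' by auto
      have g: "\<Psi> q \<le> \<Psi> p'"
      proof (cases "q < p'")
        case True
        have "{q<..<p'} \<inter> K = {}"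
        proof (rule ccontr)
          assume "{q<..<p'} \<inter> K \<noteq> {}"
          then obtain t where t: "q < t" "t < p'" "t \<in> K" by auto
          show False
            using qmax[of t] pmin[of t] t q p' by (cases "t \<le> p + \<delta>") auto
        qed
        with gap[of q p'] True q p' show ?thesis by auto
      qed (use qp' in auto)
      have pa: "a \<le> p" "q \<le> b" using Suc.prems K q by auto
      have "negligible ({p..q} \<inter> W)"
        by (rule negligible_subset[of "{p'}"]) (use W qp' in auto)
      moreover have "f integrable_on {p..q}" "f integrable_on W"
        using fS[of "{p..q}"] fS[of W] pa W(1,3) p' Suc.prems(1)
        by (force intro!: set_lebesgue_integral_eq_integral(1))+
      ultimately have "integral ({p..q} \<union> W) f = integral {p..q} f + integral W f"
        by (simp add: Henstock_Kurzweil_Integration.integral_Un)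
      then have "integral ({p..q} \<union> W) f \<le> \<Psi> b - \<Psi> p"
        using cell[of p q] g q Suc.prems W(5) by auto
      moreover have "K \<inter> {p..b} \<subseteq> {p..q} \<union> W"
      proof
        fix t assume "t \<in> K \<inter> {p..b}"
        then show "t \<in> {p..q} \<union> W"
          using qmax[of t] pmin[of t] W(2) by (cases "t \<le> p + \<delta>") auto
      qed
      moreover have "\<forall>t\<in>{p..q} \<union> W. \<exists>k\<in>K. \<bar>t - k\<bar> \<le> \<delta>"
      proof
        fix t assume "t \<in> {p..q} \<union> W"
        then show "\<exists>k\<in>K. \<bar>t - k\<bar> \<le> \<delta>"
          using W(4) q Suc.prems(2) by (cases "t \<in> W") (auto intro!: bexI[of _ p])
      qed
      moreover have "{p..q} \<union> W \<subseteq> {p..b}" using W(3) p' pa Suc.prems by auto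
      ultimately show ?thesis using W(1) by (intro bexI[of _ "{p..q} \<union> W"]) auto
    qed
  qed
  have "\<exists>W\<in>sets lebesgue. K \<subseteq> W \<and> W \<subseteq> {a..b} \<and> (\<forall>t\<in>W. \<exists>k\<in>K. \<bar>t - k\<bar> \<le> 1 / real (Suc n))
      \<and> integral W f \<le> \<Psi> b - \<Psi> a" for n
  proof -
    obtain N where "(b - a) / (1 / real (Suc n)) \<le> real N" using real_arch_simple by blast
    then have "b - a \<le> real N * (1 / real (Suc n))" by (simp add: field_simps)
    then show ?thesis using step[of "1 / real (Suc n)" a N] K(2,4) by (simp add: Int_absorb2)
  qed
  then obtain W where W: "\<And>n. W n \<in> sets lebesgue" "\<And>n. K \<subseteq> W n" "\<And>n. W n \<subseteq> {a..b}"
      "\<And>n t. t \<in> W n \<Longrightarrow> \<exists>k\<in>K. \<bar>t - k\<bar> \<le> 1 / real (Suc n)" "\<And>n. integral (W n) f \<le> \<Psi> b - \<Psi> a"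
    by metis
  have Kl: "K \<in> sets lebesgue" using K(1) by (simp add: compact_imp_closed)
  \<comment> \<open>Dominated convergence: a point outside the closed set \<open>K\<close> has
    positive distance from it, hence lies outside \<open>W n\<close> for all large
    \<open>n\<close>.\<close>
  have "(\<lambda>n. LINT t|lebesgue. indicator (W n) t *\<^sub>R f t) \<longlonglongrightarrow> (LINT t|lebesgue. indicator K t *\<^sub>R f t)"
  proof (rule integral_dominated_convergence[where w = "\<lambda>t. norm (indicator {a..b} t *\<^sub>R f t)"])
    show "integrable lebesgue (\<lambda>t. norm (indicator {a..b} t *\<^sub>R f t))"
      using f unfolding set_integrable_def by (rule integrable_norm)
    show "(\<lambda>t. indicator K t *\<^sub>R f t) \<in> borel_measurable lebesgue"
      using fS[OF Kl K(4)] unfolding set_integrable_def by auto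
    show "(\<lambda>t. indicator (W n) t *\<^sub>R f t) \<in> borel_measurable lebesgue" for n
      using fS[OF W(1,3)] unfolding set_integrable_def by auto
    show "AE t in lebesgue. norm (indicator (W n) t *\<^sub>R f t) \<le> norm (indicator {a..b} t *\<^sub>R f t)" for n
      using W(3)[of n] by (intro AE_I2) (auto simp: indicator_def)
    show "AE t in lebesgue. (\<lambda>n. indicator (W n) t *\<^sub>R f t) \<longlonglongrightarrow> indicator K t *\<^sub>R f t"
    proof (intro AE_I2)
      fix t
      show "(\<lambda>n. indicator (W n) t *\<^sub>R f t) \<longlonglongrightarrow> indicator K t *\<^sub>R f t"
      proof (cases "t \<in> K")
        case True
        then have "t \<in> W n" for n using W(2) by auto
        then show ?thesis using True by simp
      next
        case False
        then obtain e where e: "e > 0" "\<And>k. k \<in> K \<Longrightarrow> e \<le> dist t k"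
          using separate_point_closed[OF compact_imp_closed[OF K(1)] False] by auto
        obtain N where N: "1 / real (Suc N) < e" using e(1) nat_approx_posE by blast
        have "t \<notin> W n" if "n \<ge> N" for n
        proof
          assume "t \<in> W n"
          then obtain k where "k \<in> K" "\<bar>t - k\<bar> \<le> 1 / real (Suc n)" using W(4) by blast
          moreover have "1 / real (Suc n) \<le> 1 / real (Suc N)" using that by (simp add: frac_le)
          ultimately show False using e(2)[of k] N by (auto simp: dist_real_def)
        qed
        then have "\<forall>\<^sub>F n in sequentially. indicator (W n) t *\<^sub>R f t = indicator K t *\<^sub>R f t"
          using False by (auto simp: eventually_sequentially intro!: exI[of _ N])
        then show ?thesis by (rule tendsto_eventually)
      qed
    qed
  qed
  moreover have "(LINT t|lebesgue. indicator S t *\<^sub>R f t) = integral S f" if "S \<in> sets lebesgue" "S \<subseteq> {a..b}" for S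
    using set_lebesgue_integral_eq_integral(2)[OF fS[OF that]] unfolding set_lebesgue_integral_def .
  ultimately have "(\<lambda>n. integral (W n) f) \<longlonglongrightarrow> integral K f" using W(1,3) Kl K(4) by simp
  then show ?thesis by (rule LIMSEQ_le_const2) (use W(5) in auto)
qed

text \<open>For a compact T contained in \<open>{t \<in> K. 0 < h t}\<close> the covering lemma with
  \<Psi> = 0 gives \<open>integral T h \<le> 0\<close>, while h > 0 on T; so T is null. Inner
  regularity passes from such T to the whole set.\<close>

lemma negligible_positive_part_of_decreasing:
  fixes h :: "real \<Rightarrow> real" and K :: "real set"
  assumes K: "compact K" "K \<subseteq> {a..b}"
    and h: "h absolutely_integrable_on {a..b}"
    and le: "\<And>p q. \<lbrakk>p \<in> K; q \<in> K; p \<le> q\<rbrakk> \<Longrightarrow> integral {p..q} h \<le> 0"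
  shows "negligible {t \<in> K. 0 < h t}"
proof -
  define A where "A = {t \<in> K. 0 < h t}"
  have hS: "h absolutely_integrable_on S" if "S \<in> sets lebesgue" "S \<subseteq> {a..b}" for S
    using set_integrable_subset[OF h] that by auto
  have Kl: "K \<in> sets lebesgue" using K(1) by (simp add: compact_imp_closed)
  have "(\<lambda>t. indicator K t *\<^sub>R h t) \<in> borel_measurable lebesgue"
    using hS[OF Kl K(2)] unfolding set_integrable_def by auto
  then have "{t \<in> space lebesgue. 0 < indicator K t *\<^sub>R h t} \<in> sets lebesgue"
    by measurable
  moreover have "{t \<in> space lebesgue. 0 < indicator K t *\<^sub>R h t} = A"
    by (auto simp: A_def indicator_def split: if_splits)
  ultimately have Al: "A \<in> sets lebesgue" by simp
  have null: "T \<in> null_sets lebesgue" if T: "compact T" "T \<subseteq> A" for T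
  proof (cases "T = {}")
    case False
    have TK: "T \<subseteq> K" using T(2) by (auto simp: A_def)
    have Tl: "T \<in> sets lebesgue" using T(1) by (simp add: compact_imp_closed)
    obtain a' b' where ab': "a' \<in> T" "b' \<in> T" "T \<subseteq> {a'..b'}"
      using compact_attains_inf[OF T(1) False] compact_attains_sup[OF T(1) False] by (metis atLeastAtMost_iff subsetI)
    have "{a'..b'} \<subseteq> {a..b}" using ab' TK K(2) by auto
    then have "integral T h \<le> (\<lambda>_. 0::real) b' - (\<lambda>_. 0) a'"
      using ab' le[OF subsetD[OF TK] subsetD[OF TK]] hS[of "{a'..b'}"]
      by (intro integral_compact_le_of_gaps[OF T(1), where \<Psi> = "\<lambda>_. 0"]) auto
    then have le0: "integral T h \<le> 0" by simp
    have iT: "h absolutely_integrable_on T" using hS[OF Tl] TK K(2) by auto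
    have int: "integrable lebesgue (\<lambda>t. indicator T t *\<^sub>R h t)" using iT unfolding set_integrable_def .
    have nn: "AE t in lebesgue. 0 \<le> indicator T t *\<^sub>R h t"
      using T(2) by (intro AE_I2) (auto simp: A_def indicator_def)
    have "(LINT t|lebesgue. indicator T t *\<^sub>R h t) \<le> 0"
      using set_lebesgue_integral_eq_integral(2)[OF iT] le0 unfolding set_lebesgue_integral_def by simp
    then have "(LINT t|lebesgue. indicator T t *\<^sub>R h t) = 0" using integral_nonneg_AE[OF nn] by simp
    then have "AE t in lebesgue. indicator T t *\<^sub>R h t = 0"
      using integral_nonneg_eq_0_iff_AE[OF int nn] by simp
    then have "AE t in lebesgue. t \<notin> T"
      by eventually_elim (use T(2) in \<open>auto simp: A_def indicator_def\<close>)
    then show ?thesis using Tl by (simp add: AE_iff_null_sets)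
  qed auto
  have "emeasure lebesgue A \<le> 0"
  proof (rule ennreal_le_epsilon)
    fix e :: real assume "0 < e"
    then obtain T where T: "closed T" "T \<subseteq> A" "A - T \<in> lmeasurable" "emeasure lebesgue (A - T) < ennreal e"
      using sets_lebesgue_inner_closed[OF Al] by blast
    have "compact T" using T(1,2) K(1) unfolding A_def
      by (metis (no_types, lifting) bounded_subset compact_eq_bounded_closed mem_Collect_eq subset_iff)
    then have "emeasure lebesgue (A - T) = emeasure lebesgue A"
      using null[OF _ T(2)] Al by (simp add: emeasure_Diff_null_set)
    then show "emeasure lebesgue A \<le> 0 + ennreal e" using T(4) by simp
  qed
  then have "A \<in> null_sets lebesgue" using Al by auto
  then show ?thesis by (simp add: A_def negligible_iff_null_sets)
qed

text \<open>Let \<open>K\<close> consist of the points after which the primitive \<open>H\<close> of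
  \<open>h\<close> never exceeds its current value. \<open>H\<close> decreases along
  \<open>K\<close>, so h \<le> 0 almost everywhere there and f is nonnegative. The gaps of
  \<open>K\<close> are blocks on which \<open>h\<close> has integral zero, and the covering lemma
  with the primitive \<open>F\<close> of \<open>f\<close> adds them up. Nonpositive primitives on
  the whole interval are what puts \<open>a\<close> into \<open>K\<close>.\<close>

lemma sunrise_principle_aux:
  fixes f h :: "real \<Rightarrow> real"
  assumes ab: "a \<le> b"
    and h: "h absolutely_integrable_on {a..b}" and f: "f absolutely_integrable_on {a..b}"
    and le: "\<And>t. t \<in> {a..b} \<Longrightarrow> integral {a..t} h \<le> 0"
    and pointwise: "\<And>t. \<lbrakk>t \<in> {a..b}; h t \<le> 0\<rbrakk> \<Longrightarrow> 0 \<le> f t"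
    and block: "\<And>c d. \<lbrakk>a \<le> c; c < d; d \<le> b; integral {c..d} h = 0\<rbrakk> \<Longrightarrow> 0 \<le> integral {c..d} f"
  shows "0 \<le> integral {a..b} f"
proof -
  have hi: "h integrable_on {a..b}" and fi: "f integrable_on {a..b}"
    using h f set_lebesgue_integral_eq_integral(1) by auto
  define H where "H t = integral {a..t} h" for t
  define F where "F t = integral {a..t} f" for t
  have diff: "integral {p..q} g = integral {a..q} g - integral {a..p} g"
    if "g integrable_on {a..b}" "a \<le> p" "p \<le> q" "q \<le> b" for g :: "real \<Rightarrow> real" and p q
    using Henstock_Kurzweil_Integration.integral_combine[of a p q g] integrable_on_subinterval[OF that(1), of a q] that by auto
  have Hc: "continuous_on {a..b} H"
    unfolding H_def by (rule indefinite_integral_continuous_1[OF hi])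
  define K where "K = {t \<in> {a..b}. \<forall>s\<in>{t..b}. H s \<le> H t}"
  have clK: "closed K"
    unfolding closed_sequential_limits
  proof (intro allI impI, elim conjE)
    fix x l assume x: "\<forall>n. x n \<in> K" "x \<longlonglongrightarrow> l"
    have lab: "l \<in> {a..b}"
      using closed_sequentially[of "{a..b}" x l] x by (auto simp: K_def)
    have xl: "(\<lambda>n. H (x n)) \<longlonglongrightarrow> H l"
      using continuous_on_tendsto_compose[OF Hc x(2) lab] x(1) by (auto simp: K_def)
    have "H s \<le> H l" if s: "s \<in> {l..b}" for s
    proof (cases "s = l")
      case False
      then have "\<forall>\<^sub>F n in sequentially. x n < s" using order_tendstoD(2)[OF x(2), of s] s by auto
      then have "\<forall>\<^sub>F n in sequentially. H s \<le> H (x n)"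
        by eventually_elim (use x(1) s in \<open>auto simp: K_def\<close>)
      then show ?thesis using tendsto_lowerbound[OF xl] by simp
    qed simp
    with lab show "l \<in> K" by (auto simp: K_def)
  qed
  have Kab: "K \<subseteq> {a..b}" by (auto simp: K_def)
  have cK: "compact K" using clK Kab bounded_subset[OF bounded_closed_interval]
    by (auto simp: compact_eq_bounded_closed)
  have aK: "a \<in> K" using ab le by (auto simp: K_def H_def)
  have bK: "b \<in> K" using ab by (auto simp: K_def)
  have Hgap: "H p = H q" if g: "p \<in> K" "q \<in> K" "p < q" "{p<..<q} \<inter> K = {}" for p q
  proof (rule antisym)
    show "H q \<le> H p" using g Kab by (auto simp: K_def)
    have pq: "a \<le> p" "q \<le> b" using g Kab by auto
    \<comment> \<open>A point \<open>s\<close> where \<open>H\<close> is largest on [t, b] belongs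
      to \<open>K\<close>. It cannot lie in the gap, so s \<ge> q and H t \<le> H s \<le> H q;
      letting t tend to p gives the missing inequality.\<close>
    have lt: "H t \<le> H q" if t: "t \<in> {p<..q}" for t
    proof -
      have "continuous_on {t..b} H" by (rule continuous_on_subset[OF Hc]) (use t pq in auto)
      then obtain s where s: "s \<in> {t..b}" "\<And>r. r \<in> {t..b} \<Longrightarrow> H r \<le> H s"
        using continuous_attains_sup[of "{t..b}" H] t pq by fastforce
      have "s \<in> K" using s t pq by (auto simp: K_def)
      then have "q \<le> s" using g(4) s(1) t by (metis IntI empty_iff greaterThanLessThan_iff greaterThanAtMost_iff atLeastAtMost_iff not_le less_le_trans)
      then have "H s \<le> H q" using g(2) s(1) by (auto simp: K_def)
      with s(2)[of t] t pq show ?thesis by auto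
    qed
    have "(H \<longlongrightarrow> H p) (at_right p)"
      using Hc pq g(3) continuous_on_Icc_at_rightD[of p q H] continuous_on_subset[OF Hc, of "{p..q}"] by auto
    moreover have "\<forall>\<^sub>F t in at_right p. H t \<le> H q"
      using lt g(3) unfolding eventually_at_right_field by (intro exI[of _ q]) auto
    ultimately show "H p \<le> H q" by (rule tendsto_upperbound) simp
  qed
  have "integral K f \<le> F b - F a"
  proof (rule integral_compact_le_of_gaps[OF cK aK bK Kab f])
    fix p q assume pq: "p \<in> K" "q \<in> K" "p \<le> q"
    then have "a \<le> p" "q \<le> b" using Kab by auto
    then show "integral {p..q} f \<le> F q - F p"
      using diff[OF fi, of p q] pq(3) by (simp add: F_def)
  next
    fix p q assume pq: "p \<in> K" "q \<in> K" "p < q" "{p<..<q} \<inter> K = {}"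
    then have i: "a \<le> p" "q \<le> b" using Kab by auto
    then have "integral {p..q} h = 0"
      using diff[OF hi, of p q] Hgap[OF pq] pq(3) by (simp add: H_def)
    then have "0 \<le> integral {p..q} f" using block i pq by auto
    then show "F p \<le> F q" using diff[OF fi, of p q] i pq(3) by (simp add: F_def)
  qed
  also have "F b - F a = integral {a..b} f" by (simp add: F_def)
  finally have "integral K f \<le> integral {a..b} f" .
  moreover have "0 \<le> integral K f"
  proof -
    have neg: "negligible {t \<in> K. 0 < h t}"
    proof (rule negligible_positive_part_of_decreasing[OF cK Kab h])
      fix p q assume pq: "p \<in> K" "q \<in> K" "p \<le> q"
      then show "integral {p..q} h \<le> 0"
        using diff[OF hi, of p q] by (auto simp: K_def H_def)
    qed
    have "integral K f = integral K (\<lambda>t. if 0 < h t then 0 else f t)"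
      by (rule integral_spike[OF neg]) auto
    also have "0 \<le> \<dots>"
    proof (rule Henstock_Kurzweil_Integration.integral_nonneg)
      have "f integrable_on K"
        using set_integrable_subset[OF f _ Kab] clK set_lebesgue_integral_eq_integral(1) by auto
      then show "(\<lambda>t. if 0 < h t then 0 else f t) integrable_on K"
        by (rule integrable_spike[OF _ neg]) auto
    qed (use pointwise Kab in force)
    finally show ?thesis .
  qed
  ultimately show ?thesis by simp
qed

text \<open>This packages Riesz' rising sun lemma: on the complement of the set of points from which the
  primitive of \<open>h\<close> never rises above its current value, one finds intervals of mean zero for \<open>h\<close>,
  while \<open>h \<le> 0\<close> almost everywhere on the set itself.\<close>

lemma sunrise_principle:
  fixes f h :: "real \<Rightarrow> real"
  assumes ab: "a \<le> b"
    and h: "h absolutely_integrable_on {a..b}" and f: "f absolutely_integrable_on {a..b}"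
    and le: "integral {a..b} h \<le> 0"
    and pointwise: "\<And>t. \<lbrakk>t \<in> {a..b}; h t \<le> 0\<rbrakk> \<Longrightarrow> 0 \<le> f t"
    and block: "\<And>c d. \<lbrakk>a \<le> c; c < d; d \<le> b; integral {c..d} h = 0\<rbrakk> \<Longrightarrow> 0 \<le> integral {c..d} f"
  shows "0 \<le> integral {a..b} f"
proof -
  have hi: "h integrable_on {a..b}" and fi: "f integrable_on {a..b}"
    using h f set_lebesgue_integral_eq_integral(1) by auto
  have Hc: "continuous_on {a..b} (\<lambda>t. integral {a..t} h)"
    by (rule indefinite_integral_continuous_1[OF hi])
  define Z where "Z = {t \<in> {a..b}. integral {a..t} h = 0}"
  have cZ: "closed Z" unfolding Z_def
    by (rule continuous_closed_preimage_constant[OF Hc]) simp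
  \<comment> \<open>Split at the last zero \<open>a'\<close> of the primitive of \<open>h\<close>.
    The part before it is a single block. After it the primitive stays nonpositive, since a positive
    value and the nonpositive value at \<open>b\<close> would force a later zero; so the auxiliary
    form applies there.\<close>
  define a' where "a' = Sup Z"
  have aZ: "a \<in> Z" using ab by (simp add: Z_def)
  have bdd: "bdd_above Z" by (auto simp: Z_def bdd_above_def)
  have a'Z: "a' \<in> Z" unfolding a'_def using aZ by (intro closed_contains_Sup bdd cZ) auto
  then have a': "a \<le> a'" "a' \<le> b" "integral {a..a'} h = 0" by (auto simp: Z_def)
  have neg: "integral {a..t} h \<le> 0" if t: "t \<in> {a'..b}" for t
  proof (rule ccontr)
    assume "\<not> integral {a..t} h \<le> 0"
    then have pos: "0 < integral {a..t} h" by simp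
    have "\<exists>s\<ge>t. s \<le> b \<and> integral {a..s} h = 0"
      by (rule IVT2') (use pos le t a' continuous_on_subset[OF Hc] in auto)
    then obtain s where s: "t \<le> s" "s \<le> b" "integral {a..s} h = 0" by auto
    then have "s \<in> Z" using t a' by (auto simp: Z_def)
    then have "s \<le> a'" unfolding a'_def using bdd by (rule cSup_upper)
    with s t have "t = a'" by auto
    with pos a' show False by simp
  qed
  have 1: "0 \<le> integral {a..a'} f"
    using block[of a a'] a' by (cases "a = a'") auto
  have sub: "{a'..b} \<subseteq> {a..b}" using a' by auto
  have 2: "0 \<le> integral {a'..b} f"
  proof (rule sunrise_principle_aux[of a' b h])
    show "h absolutely_integrable_on {a'..b}" "f absolutely_integrable_on {a'..b}"
      using set_integrable_subset[OF h _ sub] set_integrable_subset[OF f _ sub] by auto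
    fix t assume t: "t \<in> {a'..b}"
    have "integral {a..a'} h + integral {a'..t} h = integral {a..t} h"
      by (rule Henstock_Kurzweil_Integration.integral_combine)
        (use a' t integrable_on_subinterval[OF hi, of a t] in auto)
    then show "integral {a'..t} h \<le> 0" using neg[OF t] a' by simp
  qed (use a' pointwise block in auto)
  have "integral {a..a'} f + integral {a'..b} f = integral {a..b} f"
    by (rule Henstock_Kurzweil_Integration.integral_combine) (use a' fi in auto)
  with 1 2 show ?thesis by simp
qed

section \<open>Logarithms of weights on a compact interval\<close>

text \<open>The bound on averages is cleared of denominators and stated for compact subintervals
  with the gauge integral, the form in which intervals are cut and recombined.\<close>

definition log_A_inf_on :: "real \<Rightarrow> real \<Rightarrow> real \<Rightarrow> (real \<Rightarrow> real) \<Rightarrow> bool" where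
  "log_A_inf_on C a b \<phi> \<longleftrightarrow>
     \<phi> absolutely_integrable_on {a..b} \<and> (\<lambda>t. exp (\<phi> t)) absolutely_integrable_on {a..b} \<and>
     (\<forall>c d. a \<le> c \<longrightarrow> c < d \<longrightarrow> d \<le> b \<longrightarrow>
        integral {c..d} (\<lambda>t. exp (\<phi> t)) \<le> C * (d - c) * exp (integral {c..d} \<phi> / (d - c)))"

lemma absolutely_integrable_on_subinterval:
  fixes f :: "real \<Rightarrow> real"
  assumes "f absolutely_integrable_on {a..b}" "a \<le> c" "d \<le> b"
  shows "f absolutely_integrable_on {c..d}"
  using set_integrable_subset[OF assms(1), of "{c..d}"] assms(2,3) by auto

lemma absolutely_integrable_imp_integrable:
  fixes f :: "real \<Rightarrow> real"
  shows "f absolutely_integrable_on S \<Longrightarrow> f integrable_on S"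
  by (rule set_lebesgue_integral_eq_integral(1))

lemma log_A_inf_on_subinterval:
  assumes "log_A_inf_on C a b \<phi>" "a \<le> c" "d \<le> b"
  shows "log_A_inf_on C c d \<phi>"
  using assms absolutely_integrable_on_subinterval[OF _ assms(2,3)] unfolding log_A_inf_on_def by auto

lemma absolutely_integrable_min_const:
  fixes f :: "real \<Rightarrow> real"
  assumes "f absolutely_integrable_on {a..b}"
  shows "(\<lambda>t. min (f t) q) absolutely_integrable_on {a..b}"
proof -
  have "(\<lambda>t. q) absolutely_integrable_on {a..b}" by (rule absolutely_integrable_on_const) simp
  then have "integrable lebesgue (\<lambda>t. min (indicator {a..b} t *\<^sub>R f t) (indicator {a..b} t *\<^sub>R q))"
    using assms unfolding set_integrable_def by (intro integrable_min) auto
  moreover have "min (indicator {a..b} t *\<^sub>R f t) (indicator {a..b} t *\<^sub>R q)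
      = indicator {a..b} t *\<^sub>R min (f t) q" for t
    by (auto simp: indicator_def)
  ultimately show ?thesis unfolding set_integrable_def by simp
qed

lemma superlevel_indicator:
  fixes f :: "real \<Rightarrow> real"
  assumes f: "f absolutely_integrable_on {a..b}"
  shows "(\<lambda>t. indicator {t. l \<le> f t} t :: real) absolutely_integrable_on {a..b}" (is ?A)
    and "integral {a..b} (indicator {t. l \<le> f t}) = measure lebesgue {t \<in> {a..b}. l \<le> f t}" (is ?B)
    and "{t \<in> {a..b}. l \<le> f t} \<in> lmeasurable"
proof -
  have "(\<lambda>t. indicator {a..b} t *\<^sub>R f t) \<in> borel_measurable lebesgue"
    using f unfolding set_integrable_def by auto
  then have "{t \<in> space lebesgue. l \<le> indicator {a..b} t *\<^sub>R f t} \<in> sets lebesgue"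
    by measurable
  then have "{t \<in> space lebesgue. l \<le> indicator {a..b} t *\<^sub>R f t} \<inter> {a..b} \<in> sets lebesgue"
    by (rule sets.Int) auto
  moreover have "{t \<in> space lebesgue. l \<le> indicator {a..b} t *\<^sub>R f t} \<inter> {a..b} = {t \<in> {a..b}. l \<le> f t}"
    by auto
  ultimately show S: "{t \<in> {a..b}. l \<le> f t} \<in> lmeasurable"
    by (intro bounded_set_imp_lmeasurable bounded_subset[OF bounded_closed_interval]) auto
  have eq: "indicator {a..b} t *\<^sub>R indicator {t. l \<le> f t} t = (indicator {t \<in> {a..b}. l \<le> f t} t :: real)" for t
    by (auto simp: indicator_def)
  show ?A
    unfolding set_integrable_def eq using S by (auto simp: fmeasurable_def)
  then have "integral {a..b} (indicator {t. l \<le> f t}) = (LINT t:{a..b}|lebesgue. (indicator {t. l \<le> f t} t :: real))"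
    by (rule set_lebesgue_integral_eq_integral(2)[symmetric])
  also have "\<dots> = measure lebesgue {t \<in> {a..b}. l \<le> f t}"
    unfolding set_lebesgue_integral_def eq by simp
  finally show ?B .
qed

text \<open>On a subinterval let truncation lower the average by D \<ge> 0, and write \<gamma> for
  the truncation. Pointwise, e^\<phi> is at least e^D (e^\<gamma> + e^q (\<phi> - \<gamma> - D)),
  and the last bracket has mean zero by the choice of D. So the mean of e^\<gamma> is at most e^(-D)
  times that of e^\<phi>, while the exponential of the average drops by exactly this factor.\<close>

lemma log_A_inf_on_truncate:
  assumes \<phi>: "log_A_inf_on C a b \<phi>"
  shows "log_A_inf_on C a b (\<lambda>t. min (\<phi> t) q)"
  unfolding log_A_inf_on_def
proof (intro conjI allI impI)
  have min_exp: "exp (min (\<phi> t) q) = min (exp (\<phi> t)) (exp q)" for t by (simp add: min_def)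
  show i1: "(\<lambda>t. min (\<phi> t) q) absolutely_integrable_on {a..b}"
    using \<phi> by (intro absolutely_integrable_min_const) (auto simp: log_A_inf_on_def)
  show i2: "(\<lambda>t. exp (min (\<phi> t) q)) absolutely_integrable_on {a..b}"
    unfolding min_exp using \<phi> by (intro absolutely_integrable_min_const) (auto simp: log_A_inf_on_def)
  fix c d assume cd: "a \<le> c" "c < d" "d \<le> b"
  have int: "f absolutely_integrable_on {a..b} \<Longrightarrow> f integrable_on {c..d}" for f :: "real \<Rightarrow> real"
    using cd absolutely_integrable_imp_integrable absolutely_integrable_on_subinterval by blast
  have I: "\<phi> integrable_on {c..d}" "(\<lambda>t. exp (\<phi> t)) integrable_on {c..d}"
      "(\<lambda>t. min (\<phi> t) q) integrable_on {c..d}" "(\<lambda>t. exp (min (\<phi> t) q)) integrable_on {c..d}"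
    using \<phi> i1 i2 by (auto intro!: int simp: log_A_inf_on_def)
  define D where "D = (integral {c..d} \<phi> - integral {c..d} (\<lambda>t. min (\<phi> t) q)) / (d - c)"
  have "integral {c..d} (\<lambda>t. min (\<phi> t) q) \<le> integral {c..d} \<phi>"
    by (rule integral_le) (use I in auto)
  then have D0: "0 \<le> D" using cd by (simp add: D_def)
  \<comment> \<open>Below \<open>q\<close> this is 1 - D \<le> e^(-D) together with \<phi> \<le> q;
    above \<open>q\<close> it is 1 + s \<le> e^s with s = \<phi> - q - D.\<close>
  have pt: "exp D * (exp (min (\<phi> t) q) + exp q * (\<phi> t - min (\<phi> t) q - D)) \<le> exp (\<phi> t)" for t
  proof (cases "\<phi> t \<le> q")
    case True
    have "exp (\<phi> t) * D \<le> exp q * D" using True D0 by (intro mult_right_mono) auto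
    then have "exp (\<phi> t) + exp q * (- D) \<le> exp (\<phi> t) * (1 + - D)" by (simp add: algebra_simps)
    also have "\<dots> \<le> exp (\<phi> t) * exp (- D)" using exp_ge_add_one_self[of "- D"] by (intro mult_left_mono) auto
    finally have "exp D * (exp (\<phi> t) + exp q * (- D)) \<le> exp D * (exp (\<phi> t) * exp (- D))"
      by (intro mult_left_mono) auto
    also have "\<dots> = exp (\<phi> t)" by (simp add: exp_minus field_simps)
    finally show ?thesis using True by simp
  next
    case False
    have "exp D * exp q * (1 + (\<phi> t - q - D)) \<le> exp D * exp q * exp (\<phi> t - q - D)"
      using exp_ge_add_one_self by (intro mult_left_mono) auto
    also have "\<dots> = exp (\<phi> t)" by (simp flip: exp_add)
    finally show ?thesis using False by (simp add: algebra_simps)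
  qed
  have "((\<lambda>t. exp D * (exp (min (\<phi> t) q) + exp q * (\<phi> t - min (\<phi> t) q - D))) has_integral
      exp D * (integral {c..d} (\<lambda>t. exp (min (\<phi> t) q))
         + exp q * (integral {c..d} \<phi> - integral {c..d} (\<lambda>t. min (\<phi> t) q) - (d - c) *\<^sub>R D))) {c..d}"
    using I cd has_integral_const_real[of D c d]
    by (intro has_integral_mult_right has_integral_add has_integral_diff integrable_integral) auto
  then have "exp D * (integral {c..d} (\<lambda>t. exp (min (\<phi> t) q))
         + exp q * (integral {c..d} \<phi> - integral {c..d} (\<lambda>t. min (\<phi> t) q) - (d - c) *\<^sub>R D))
      \<le> integral {c..d} (\<lambda>t. exp (\<phi> t))"
    by (rule has_integral_le[OF _ integrable_integral[OF I(2)] pt])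
  also have "integral {c..d} \<phi> - integral {c..d} (\<lambda>t. min (\<phi> t) q) - (d - c) *\<^sub>R D = 0"
    using cd by (simp add: D_def)
  also have "integral {c..d} (\<lambda>t. exp (\<phi> t)) \<le> C * (d - c) * exp (integral {c..d} \<phi> / (d - c))"
    using \<phi> cd by (auto simp: log_A_inf_on_def)
  also have "integral {c..d} \<phi> / (d - c) = D + integral {c..d} (\<lambda>t. min (\<phi> t) q) / (d - c)"
    by (simp add: D_def diff_divide_distrib)
  finally have "exp D * integral {c..d} (\<lambda>t. exp (min (\<phi> t) q))
      \<le> exp D * (C * (d - c) * exp (integral {c..d} (\<lambda>t. min (\<phi> t) q) / (d - c)))"
    by (simp add: exp_add mult_ac)
  then show "integral {c..d} (\<lambda>t. exp (min (\<phi> t) q))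
      \<le> C * (d - c) * exp (integral {c..d} (\<lambda>t. min (\<phi> t) q) / (d - c))"
    by simp
qed

section \<open>Tail estimates on a compact interval\<close>

text \<open>The line tangent to C e^p at p = m meets the graph of e^p at p = m - x and p = m + y;
  these are the two equations assumed here, and they do not depend on m.\<close>

locale tangent_pair =
  fixes C x y :: real
  assumes x: "0 < x" "x < 1" and y: "0 < y"
    and exp_x: "exp (- x) = C * (1 - x)" and exp_y: "exp y = C * (1 + y)"
begin

lemma C_pos: "0 < C"
  using exp_y y by (smt (verit) exp_gt_zero zero_less_mult_iff)

text \<open>The distance of \<open>e\<^sup>p\<close> from its tangent at \<open>p = m - x\<close>, since \<open>C (1 - x) e\<^sup>m\<close> is the
  exponential of \<open>m - x\<close>.\<close>

definition tangent_gap :: "real \<Rightarrow> real \<Rightarrow> real" where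
  "tangent_gap m p = exp p - C * (1 - x) * exp m * (1 + x + p - m)"

lemma exp_shift: "exp (m - x) = C * (1 - x) * exp m"
proof -
  have "exp (m - x) = exp m * exp (- x)" by (simp flip: exp_add)
  then show ?thesis by (simp add: exp_x)
qed

lemma tangent_gap_nonneg: "0 \<le> tangent_gap m p"
proof -
  have "exp (m - x) * (1 + (p - (m - x))) \<le> exp (m - x) * exp (p - (m - x))"
    using exp_ge_add_one_self by (intro mult_left_mono) auto
  also have "\<dots> = exp p" by (simp flip: exp_add)
  finally show ?thesis unfolding tangent_gap_def exp_shift[symmetric] by (simp add: algebra_simps)
qed

text \<open>At p = m + y there is equality, since (1 + y) - (1 - x) (1 + x + y) = x (x + y). Further
  to the right the exponential outgrows the tangent. This is the constant in Chebyshev's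
  inequality.\<close>

lemma tangent_gap_ge:
  assumes "m + y \<le> p"
  shows "C * x * (x + y) * exp m \<le> tangent_gap m p"
proof -
  define s where "s = p - (m + y)"
  have s: "0 \<le> s" using assms by (simp add: s_def)
  have "exp p = exp m * exp y * exp s" by (simp add: s_def flip: exp_add)
  also have "exp m * exp y * exp s \<ge> exp m * exp y * (1 + s)"
    using exp_ge_add_one_self by (intro mult_left_mono) auto
  finally have 1: "exp m * (C * (1 + y)) * (1 + s) \<le> exp p" by (simp add: exp_y)
  have "exp m * (C * (1 + y)) * (1 + s) - C * (1 - x) * exp m * (1 + x + (y + s))
     = C * x * (x + y) * exp m + C * exp m * s * (x + y)"
    by (simp add: algebra_simps)
  moreover have "0 \<le> C * exp m * s * (x + y)" using C_pos s x y by simp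
  ultimately show ?thesis using 1 unfolding tangent_gap_def by (simp add: s_def algebra_simps)
qed

text \<open>Levels are weighted by exp (rate * m). This exponent makes the first order term of
  \<open>step_error\<close> cancel: rate + (1 - x) = (1 - x) (1 + x) / x.\<close>

definition rate :: real where "rate = 1 / x - 1"

lemma rate_pos: "0 < rate" using x by (simp add: rate_def field_simps)

lemma exp_rate: "exp (rate * m) * exp m = exp (m / x)"
  by (simp add: rate_def algebra_simps flip: exp_add)

text \<open>The weighted gap integral at level \<mu> minus the one at level \<mu> - \<delta>, over
  an interval of average \<mu> and length l, in the extreme case where the integral of the
  exponential is C l e^\<mu>; the common factor \<open>C * exp (\<mu> / x) * l\<close> is divided
  out.\<close>

definition step_error :: "real \<Rightarrow> real" where
  "step_error \<delta> = x\<^sup>2 - exp (- (rate * \<delta>)) + (1 - x) * (1 + x + \<delta>) * exp (- (\<delta> / x))"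

lemma step_error_0: "step_error 0 = 0" by (simp add: step_error_def power2_eq_square algebra_simps)

lemma step_error_deriv: "(step_error has_real_derivative 0) (at 0)"
proof -
  have "((\<lambda>\<delta>. x\<^sup>2 - exp (- (rate * \<delta>)) + ((1 - x) * (1 + x + \<delta>)) * exp (- (inverse x * \<delta>)))
      has_real_derivative (0 - exp (- (rate * 0)) * (- rate) +
        ((1 - x) * exp (- (inverse x * 0)) + exp (- (inverse x * 0)) * (- inverse x) * ((1 - x) * (1 + x + 0))))) (at 0)"
    by (intro derivative_intros DERIV_add DERIV_diff DERIV_mult DERIV_fun_exp DERIV_minus DERIV_const DERIV_cmult_Id) (auto intro!: derivative_eq_intros)
  moreover have "0 - exp (- (rate * 0)) * (- rate) +
        ((1 - x) * exp (- (inverse x * 0)) + exp (- (inverse x * 0)) * (- inverse x) * ((1 - x) * (1 + x + 0))) = 0"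
    using x by (simp add: rate_def field_simps)
  moreover have "step_error = (\<lambda>\<delta>. x\<^sup>2 - exp (- (rate * \<delta>)) + ((1 - x) * (1 + x + \<delta>)) * exp (- (inverse x * \<delta>)))"
    by (rule ext) (simp add: step_error_def divide_inverse mult_ac)
  ultimately show ?thesis by simp
qed

text \<open>Value and derivative vanish at 0, so one step of size L / n costs o(1/n), and n such
  steps cost nothing in the limit.\<close>

lemma step_error_limit: "(\<lambda>n. real n * \<bar>step_error (L / real n)\<bar>) \<longlonglongrightarrow> 0"
proof (cases "L = 0")
  case False
  have "((\<lambda>h. (step_error (0 + h) - step_error 0) / h) \<longlongrightarrow> 0) (at 0)"
    using step_error_deriv unfolding DERIV_def .
  then have d: "((\<lambda>h. step_error h / h) \<longlongrightarrow> 0) (at 0)" by (simp add: step_error_0)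
  have "filterlim (\<lambda>n. L / real n) (at 0) sequentially"
  proof (rule filterlim_atI)
    show "(\<lambda>n. L / real n) \<longlonglongrightarrow> 0" by (rule lim_const_over_n)
    show "\<forall>\<^sub>F n in sequentially. L / real n \<noteq> 0"
      using False eventually_gt_at_top[of "0::nat"] by (auto elim: eventually_mono)
  qed
  then have "(\<lambda>n. step_error (L / real n) / (L / real n)) \<longlonglongrightarrow> 0" by (rule filterlim_compose[OF d])
  then have "(\<lambda>n. \<bar>L * (step_error (L / real n) / (L / real n))\<bar>) \<longlonglongrightarrow> \<bar>L * 0\<bar>"
    by (intro tendsto_intros)
  moreover have "\<bar>L * (step_error (L / real n) / (L / real n))\<bar> = real n * \<bar>step_error (L / real n)\<bar>" for n
    using False by (simp add: abs_mult)
  ultimately show ?thesis by simp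
qed (simp add: step_error_0)

text \<open>On an interval of average \<open>\<mu>\<close> and length \<open>l\<close> the two brackets are the integrals of the
  tangent gaps at the levels \<open>\<mu>\<close> and \<open>\<mu> - \<delta>\<close>, where \<open>X\<close> is the integral of the exponential.\<close>

lemma level_step:
  assumes X: "X \<le> C * l * exp \<mu>" and l: "0 \<le> l" and \<delta>: "0 \<le> \<delta>" and \<mu>: "\<mu> \<le> M"
  shows "exp (rate * \<mu>) * (X - C * (1 - x) * exp \<mu> * (1 + x) * l)
    \<le> exp (rate * (\<mu> - \<delta>)) * (X - C * (1 - x) * exp (\<mu> - \<delta>) * (1 + x + \<delta>) * l)
       + C * exp (M / x) * \<bar>step_error \<delta>\<bar> * l"
proof -
  have e1: "exp (rate * (\<mu> - \<delta>)) = exp (rate * \<mu>) * exp (- (rate * \<delta>))"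
    by (simp add: right_diff_distrib flip: exp_add)
  have e2: "exp (rate * (\<mu> - \<delta>)) * exp (\<mu> - \<delta>) = exp (\<mu> / x) * exp (- (\<delta> / x))"
    unfolding exp_rate by (simp add: diff_divide_distrib flip: exp_add)
  \<comment> \<open>In the difference of the two sides \<open>X\<close> has a nonnegative
    coefficient, so its largest admissible value may be inserted.\<close>
  have "exp (- (rate * \<delta>)) \<le> 1" using rate_pos \<delta> by simp
  then have "exp (rate * \<mu>) * (1 - exp (- (rate * \<delta>))) * X \<le> exp (rate * \<mu>) * (1 - exp (- (rate * \<delta>))) * (C * l * exp \<mu>)"
    using X by (intro mult_left_mono) auto
  also have "\<dots> = (exp (rate * \<mu>) * exp \<mu>) * (1 - exp (- (rate * \<delta>))) * (C * l)" by simp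
  finally have 1: "exp (rate * \<mu>) * X - exp (rate * (\<mu> - \<delta>)) * X \<le> exp (\<mu> / x) * (1 - exp (- (rate * \<delta>))) * (C * l)"
    unfolding exp_rate e1 by (simp add: algebra_simps)
  have "exp (rate * \<mu>) * (X - C * (1 - x) * exp \<mu> * (1 + x) * l)
      - exp (rate * (\<mu> - \<delta>)) * (X - C * (1 - x) * exp (\<mu> - \<delta>) * (1 + x + \<delta>) * l)
    = (exp (rate * \<mu>) * X - exp (rate * (\<mu> - \<delta>)) * X)
      - C * (1 - x) * (1 + x) * l * (exp (rate * \<mu>) * exp \<mu>)
      + C * (1 - x) * (1 + x + \<delta>) * l * (exp (rate * (\<mu> - \<delta>)) * exp (\<mu> - \<delta>))"
    by (simp add: algebra_simps)
  also have "\<dots> \<le> exp (\<mu> / x) * (1 - exp (- (rate * \<delta>))) * (C * l)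
      - C * (1 - x) * (1 + x) * l * exp (\<mu> / x)
      + C * (1 - x) * (1 + x + \<delta>) * l * (exp (\<mu> / x) * exp (- (\<delta> / x)))"
    unfolding e2 unfolding exp_rate using 1 by simp
  also have "\<dots> = C * exp (\<mu> / x) * l * step_error \<delta>"
    by (simp add: step_error_def algebra_simps power2_eq_square)
  also have "\<dots> \<le> C * exp (\<mu> / x) * l * \<bar>step_error \<delta>\<bar>" using C_pos l by (intro mult_left_mono) auto
  also have "\<dots> \<le> C * exp (M / x) * l * \<bar>step_error \<delta>\<bar>"
    using C_pos l \<mu> x by (intro mult_right_mono mult_left_mono) (auto simp: divide_right_mono)
  finally show ?thesis by (simp add: mult_ac)
qed

lemma integral_tangent_gap:
  assumes "log_A_inf_on C c d \<phi>" "c \<le> d"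
  shows "(\<lambda>t. tangent_gap m (\<phi> t)) absolutely_integrable_on {c..d}"
    and "integral {c..d} (\<lambda>t. tangent_gap m (\<phi> t)) = integral {c..d} (\<lambda>t. exp (\<phi> t))
      - C * (1 - x) * exp m * ((1 + x - m) * (d - c) + integral {c..d} \<phi>)"
proof -
  have eq: "tangent_gap m (\<phi> t) = exp (\<phi> t) - (C * (1 - x) * exp m * (1 + x - m) + C * (1 - x) * exp m * \<phi> t)" for t
    by (simp add: tangent_gap_def algebra_simps)
  have I: "\<phi> absolutely_integrable_on {c..d}" "(\<lambda>t. exp (\<phi> t)) absolutely_integrable_on {c..d}"
    using assms by (auto simp: log_A_inf_on_def)
  then show "(\<lambda>t. tangent_gap m (\<phi> t)) absolutely_integrable_on {c..d}"
    unfolding eq by (intro set_integral_diff set_integral_add set_integrable_mult_right absolutely_integrable_on_const) auto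
  have J: "\<phi> integrable_on {c..d}" "(\<lambda>t. exp (\<phi> t)) integrable_on {c..d}"
    using I absolutely_integrable_imp_integrable by auto
  have "((\<lambda>t. tangent_gap m (\<phi> t)) has_integral (integral {c..d} (\<lambda>t. exp (\<phi> t))
      - ((d - c) *\<^sub>R (C * (1 - x) * exp m * (1 + x - m)) + C * (1 - x) * exp m * integral {c..d} \<phi>))) {c..d}"
    unfolding eq
    using J assms(2) has_integral_const_real[of "C * (1 - x) * exp m * (1 + x - m)" c d]
    by (intro has_integral_diff has_integral_add has_integral_mult_right integrable_integral) auto
  then show "integral {c..d} (\<lambda>t. tangent_gap m (\<phi> t)) = integral {c..d} (\<lambda>t. exp (\<phi> t))
      - C * (1 - x) * exp m * ((1 + x - m) * (d - c) + integral {c..d} \<phi>)"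
    by (auto dest!: integral_unique simp: algebra_simps)
qed

text \<open>Induction on the number of steps \<delta> between the average and M. With no step left
  this is Chebyshev's inequality. Otherwise let \<mu> be one step above the average: the sunrise
  principle leads to subintervals of average \<mu>, where the induction hypothesis and then
  \<open>level_step\<close> apply, and to points with \<phi> \<le> \<mu>, where the indicator
  vanishes.\<close>

lemma level_induct:
  assumes "log_A_inf_on C c d \<phi>" "c < d" "0 \<le> \<delta>"
    and "integral {c..d} \<phi> = (M - real n * \<delta>) * (d - c)"
  shows "C * x * (x + y) * exp (M / x) * integral {c..d} (indicator {t. M + y \<le> \<phi> t})
    \<le> exp (rate * (M - real n * \<delta>)) * integral {c..d} (\<lambda>t. tangent_gap (M - real n * \<delta>) (\<phi> t))
       + real n * (C * exp (M / x) * \<bar>step_error \<delta>\<bar>) * (d - c)"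
  using assms
proof (induction n arbitrary: c d)
  case 0
  have \<phi>: "\<phi> absolutely_integrable_on {c..d}" using 0 by (simp add: log_A_inf_on_def)
  have pt: "C * x * (x + y) * exp M * indicator {t. M + y \<le> \<phi> t} t \<le> tangent_gap M (\<phi> t)" for t
    using tangent_gap_ge[of M "\<phi> t"] tangent_gap_nonneg[of M "\<phi> t"] by (auto simp: indicator_def)
  have "integral {c..d} (\<lambda>t. C * x * (x + y) * exp M * indicator {t. M + y \<le> \<phi> t} t)
      \<le> integral {c..d} (\<lambda>t. tangent_gap M (\<phi> t))"
    using superlevel_indicator(1)[OF \<phi>, of "M + y"] integral_tangent_gap(1)[OF 0(1), of M] 0(2) pt
    by (intro integral_le) (auto intro!: absolutely_integrable_imp_integrable)
  then have "exp (rate * M) * (C * x * (x + y) * exp M * integral {c..d} (indicator {t. M + y \<le> \<phi> t}))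
      \<le> exp (rate * M) * integral {c..d} (\<lambda>t. tangent_gap M (\<phi> t))"
    by (intro mult_left_mono) auto
  then show ?case by (simp add: exp_rate[symmetric] mult_ac)
next
  case (Suc n)
  define \<mu> where "\<mu> = M - real n * \<delta>"
  define E where "E = C * exp (M / x) * \<bar>step_error \<delta>\<bar>"
  define \<kappa> where "\<kappa> = C * x * (x + y) * exp (M / x)"
  have E0: "0 \<le> E" using C_pos by (simp add: E_def)
  have \<mu>M: "\<mu> \<le> M" using Suc.prems by (simp add: \<mu>_def)
  have \<mu>': "M - real (Suc n) * \<delta> = \<mu> - \<delta>" by (simp add: \<mu>_def algebra_simps)
  \<comment> \<open>The allowed error enters as a constant density, hence is proportional to length
    on each subinterval: n units pay for the induction hypothesis and one for
    \<open>level_step\<close>.\<close>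
  define f where "f t = (exp (rate * (\<mu> - \<delta>)) * tangent_gap (\<mu> - \<delta>) (\<phi> t) + real (Suc n) * E)
     - \<kappa> * indicator {t. M + y \<le> \<phi> t} t" for t
  have \<phi>: "\<phi> absolutely_integrable_on {c..d}" using Suc.prems by (simp add: log_A_inf_on_def)
  have f_abs: "f absolutely_integrable_on {c..d}"
    unfolding f_def using superlevel_indicator(1)[OF \<phi>] integral_tangent_gap(1)[OF Suc.prems(1)] Suc.prems(2)
    by (intro set_integral_diff set_integral_add set_integrable_mult_right absolutely_integrable_on_const) auto
  have f_int: "integral {c'..d'} f = exp (rate * (\<mu> - \<delta>)) * integral {c'..d'} (\<lambda>t. tangent_gap (\<mu> - \<delta>) (\<phi> t))
      + real (Suc n) * E * (d' - c') - \<kappa> * integral {c'..d'} (indicator {t. M + y \<le> \<phi> t})"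
    if "c \<le> c'" "c' < d'" "d' \<le> d" for c' d'
  proof -
    have A: "log_A_inf_on C c' d' \<phi>" using log_A_inf_on_subinterval[OF Suc.prems(1)] that by auto
    then have "(\<lambda>t. tangent_gap (\<mu> - \<delta>) (\<phi> t)) integrable_on {c'..d'}"
      "(\<lambda>t. indicator {t. M + y \<le> \<phi> t} t :: real) integrable_on {c'..d'}"
      using integral_tangent_gap(1)[OF A] that superlevel_indicator(1)[of c' d' \<phi> "M + y"]
      by (auto simp: log_A_inf_on_def intro!: absolutely_integrable_imp_integrable)
    then have "(f has_integral exp (rate * (\<mu> - \<delta>)) * integral {c'..d'} (\<lambda>t. tangent_gap (\<mu> - \<delta>) (\<phi> t))
      + (d' - c') *\<^sub>R (real (Suc n) * E) - \<kappa> * integral {c'..d'} (indicator {t. M + y \<le> \<phi> t})) {c'..d'}"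
      unfolding f_def using that has_integral_const_real[of "real (Suc n) * E" c' d']
      by (intro has_integral_diff has_integral_add has_integral_mult_right integrable_integral) auto
    then show ?thesis by (auto dest!: integral_unique simp: algebra_simps)
  qed
  have h_int: "integral {c'..d'} (\<lambda>t. \<phi> t - \<mu>) = integral {c'..d'} \<phi> - \<mu> * (d' - c')"
    if "c \<le> c'" "c' < d'" "d' \<le> d" for c' d'
  proof -
    have "\<phi> integrable_on {c'..d'}"
      using absolutely_integrable_on_subinterval[OF \<phi>] that absolutely_integrable_imp_integrable by auto
    then show ?thesis using that by (subst Henstock_Kurzweil_Integration.integral_diff) auto
  qed
  have "0 \<le> integral {c..d} f"
  proof (rule sunrise_principle[where h = "\<lambda>t. \<phi> t - \<mu>"])
    show "c \<le> d" using Suc.prems by simp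
    show "(\<lambda>t. \<phi> t - \<mu>) absolutely_integrable_on {c..d}"
      using \<phi> by (intro set_integral_diff absolutely_integrable_on_const) auto
    show "f absolutely_integrable_on {c..d}" by (rule f_abs)
    show "integral {c..d} (\<lambda>t. \<phi> t - \<mu>) \<le> 0"
      using h_int[of c d] Suc.prems(2-4) unfolding \<mu>' by (simp add: mult_right_mono)
    show "0 \<le> f t" if "\<phi> t - \<mu> \<le> 0" for t
    proof -
      have "\<phi> t < M + y" using that \<mu>M y by simp
      then show ?thesis using tangent_gap_nonneg E0 by (simp add: f_def)
    qed
    fix c' d' assume cd: "c \<le> c'" "c' < d'" "d' \<le> d" "integral {c'..d'} (\<lambda>t. \<phi> t - \<mu>) = 0"
    then have avg: "integral {c'..d'} \<phi> = \<mu> * (d' - c')" using h_int by simp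
    have A: "log_A_inf_on C c' d' \<phi>" using log_A_inf_on_subinterval[OF Suc.prems(1)] cd by auto
    have IH: "\<kappa> * integral {c'..d'} (indicator {t. M + y \<le> \<phi> t})
        \<le> exp (rate * \<mu>) * integral {c'..d'} (\<lambda>t. tangent_gap \<mu> (\<phi> t)) + real n * E * (d' - c')"
      using Suc.IH[OF A cd(2) Suc.prems(3)] avg by (simp add: \<mu>_def \<kappa>_def E_def)
    define X where "X = integral {c'..d'} (\<lambda>t. exp (\<phi> t))"
    have "X \<le> C * (d' - c') * exp (integral {c'..d'} \<phi> / (d' - c'))"
      using A cd by (simp add: log_A_inf_on_def X_def)
    then have X: "X \<le> C * (d' - c') * exp \<mu>" using avg cd by simp
    have g1: "integral {c'..d'} (\<lambda>t. tangent_gap \<mu> (\<phi> t)) = X - C * (1 - x) * exp \<mu> * (1 + x) * (d' - c')"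
      using integral_tangent_gap(2)[OF A, of \<mu>] cd avg by (simp add: X_def algebra_simps)
    have g2: "integral {c'..d'} (\<lambda>t. tangent_gap (\<mu> - \<delta>) (\<phi> t)) = X - C * (1 - x) * exp (\<mu> - \<delta>) * (1 + x + \<delta>) * (d' - c')"
      using integral_tangent_gap(2)[OF A, of "\<mu> - \<delta>"] cd avg by (simp add: X_def algebra_simps)
    have "exp (rate * \<mu>) * integral {c'..d'} (\<lambda>t. tangent_gap \<mu> (\<phi> t))
       \<le> exp (rate * (\<mu> - \<delta>)) * integral {c'..d'} (\<lambda>t. tangent_gap (\<mu> - \<delta>) (\<phi> t)) + E * (d' - c')"
      unfolding g1 g2 E_def using level_step[OF X _ Suc.prems(3) \<mu>M] cd by simp
    with IH show "0 \<le> integral {c'..d'} f"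
      using f_int[of c' d'] cd by (simp add: algebra_simps)
  qed
  then show ?case
    using f_int[of c d] Suc.prems(2) unfolding \<mu>' by (simp add: \<kappa>_def E_def)
qed

text \<open>Take n steps of size L / n from the average m to the level m + L and let n grow. The gap
  integral at level m is at most C x^2 e^m (b - a), because 1 - (1 - x) (1 + x) = x^2.\<close>

lemma exponential_tail:
  assumes A: "log_A_inf_on C a b \<phi>" and ab: "a < b" and L: "0 \<le> L"
    and avg: "integral {a..b} \<phi> = m * (b - a)"
  shows "measure lebesgue {t \<in> {a..b}. m + L + y \<le> \<phi> t} \<le> x / (x + y) * exp (- L / x) * (b - a)"
proof -
  define N where "N = integral {a..b} (indicator {t. m + L + y \<le> \<phi> t} :: real \<Rightarrow> real)"
  define B where "B = C * exp ((m + L) / x) * (b - a)"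
  have le: "C * x * (x + y) * exp ((m + L) / x) * N
      \<le> C * x\<^sup>2 * exp (m / x) * (b - a) + B * (real n * \<bar>step_error (L / real n)\<bar>)" if "0 < n" for n
  proof -
    have n: "m + L - real n * (L / real n) = m" using that by simp
    have "C * x * (x + y) * exp ((m + L) / x) * N \<le> exp (rate * m) * integral {a..b} (\<lambda>t. tangent_gap m (\<phi> t))
       + real n * (C * exp ((m + L) / x) * \<bar>step_error (L / real n)\<bar>) * (b - a)"
      using level_induct[OF A ab, of "L / real n" "m + L" n] avg L unfolding n by (simp add: N_def)
    moreover have "integral {a..b} (\<lambda>t. exp (\<phi> t)) \<le> C * (b - a) * exp (integral {a..b} \<phi> / (b - a))"
      using A ab by (simp add: log_A_inf_on_def)
    then have "integral {a..b} (\<lambda>t. exp (\<phi> t)) \<le> C * (b - a) * exp m" using avg ab by simp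
    then have "integral {a..b} (\<lambda>t. tangent_gap m (\<phi> t)) \<le> C * x\<^sup>2 * exp m * (b - a)"
      using integral_tangent_gap(2)[OF A, of m] avg ab by (simp add: algebra_simps power2_eq_square)
    then have "exp (rate * m) * integral {a..b} (\<lambda>t. tangent_gap m (\<phi> t)) \<le> exp (rate * m) * (C * x\<^sup>2 * exp m * (b - a))"
      by (intro mult_left_mono) auto
    also have "\<dots> = C * x\<^sup>2 * exp (m / x) * (b - a)" by (simp add: exp_rate[symmetric])
    ultimately show ?thesis by (simp add: B_def algebra_simps)
  qed
  have "C * x * (x + y) * exp ((m + L) / x) * N \<le> C * x\<^sup>2 * exp (m / x) * (b - a) + B * 0"
  proof (rule LIMSEQ_le_const)
    show "(\<lambda>n. C * x\<^sup>2 * exp (m / x) * (b - a) + B * (real n * \<bar>step_error (L / real n)\<bar>))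
        \<longlonglongrightarrow> C * x\<^sup>2 * exp (m / x) * (b - a) + B * 0"
      by (intro tendsto_intros step_error_limit)
  qed (use le in \<open>auto intro!: exI[of _ 1]\<close>)
  then have "(C * x * exp (m / x)) * ((x + y) * exp (L / x) * N) \<le> (C * x * exp (m / x)) * (x * (b - a))"
    by (simp add: add_divide_distrib exp_add power2_eq_square mult_ac)
  then have "(x + y) * exp (L / x) * N \<le> x * (b - a)"
    using C_pos x by (subst (asm) mult_le_cancel_left_pos) auto
  then have "N \<le> x * (b - a) / ((x + y) * exp (L / x))"
    using x y by (simp add: pos_le_divide_eq mult_ac add_pos_pos)
  also have "\<dots> = x / (x + y) * exp (- L / x) * (b - a)" by (simp add: exp_minus divide_inverse mult_ac)
  also have "N = measure lebesgue {t \<in> {a..b}. m + L + y \<le> \<phi> t}"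
    unfolding N_def by (rule superlevel_indicator(2)) (use A in \<open>simp only: log_A_inf_on_def\<close>)
  finally show ?thesis .
qed

text \<open>With u = q - y, the affine function (x - u + \<gamma>) / (x + y) of the truncation
  \<gamma> is 1 at \<gamma> = q and x / (x + y) at \<gamma> = u. It dominates the indicator where
  \<gamma> \<ge> u, and on subintervals of average u its mean is the bound of
  \<open>exponential_tail\<close> with L = 0. The sunrise principle combines the two when the
  average of \<gamma> exceeds u; otherwise \<open>exponential_tail\<close> applies directly.\<close>

lemma linear_tail:
  assumes A: "log_A_inf_on C a b \<phi>" and ab: "a < b" and lam: "lam \<le> y"
    and avg: "integral {a..b} \<phi> = m * (b - a)"
  shows "measure lebesgue {t \<in> {a..b}. m + lam \<le> \<phi> t} \<le> (1 - lam / (x + y)) * (b - a)"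
proof -
  define q where "q = m + lam"
  define \<gamma> where "\<gamma> = (\<lambda>t. min (\<phi> t) q)"
  have G: "log_A_inf_on C a b \<gamma>" unfolding \<gamma>_def by (rule log_A_inf_on_truncate[OF A])
  have \<gamma>q: "\<gamma> t \<le> q" for t by (simp add: \<gamma>_def)
  have \<phi>a: "\<phi> absolutely_integrable_on {a..b}" and \<gamma>a: "\<gamma> absolutely_integrable_on {a..b}"
    using A G by (auto simp: log_A_inf_on_def)
  define k where "k = integral {a..b} \<gamma> / (b - a)"
  have avgk: "integral {a..b} \<gamma> = k * (b - a)" using ab by (simp add: k_def)
  have "integral {a..b} \<gamma> \<le> integral {a..b} \<phi>"
    using \<phi>a \<gamma>a by (intro integral_le) (auto simp: \<gamma>_def intro!: absolutely_integrable_imp_integrable)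
  then have km: "k \<le> m" using avg avgk ab by simp
  have sets_eq: "{t \<in> {a..b}. m + lam \<le> \<phi> t} = {t \<in> {a..b}. q \<le> \<gamma> t}"
    by (auto simp: \<gamma>_def q_def)
  show ?thesis
  proof (cases "y \<le> q - k")
    case True
    have "measure lebesgue {t \<in> {a..b}. q \<le> \<gamma> t} \<le> x / (x + y) * exp (- (q - k - y) / x) * (b - a)"
      using exponential_tail[OF G ab _ avgk, of "q - k - y"] True by simp
    also have "\<dots> \<le> x / (x + y) * 1 * (b - a)"
      using x y ab True by (intro mult_right_mono mult_left_mono) (auto intro: divide_nonpos_pos)
    also have "\<dots> \<le> (1 - lam / (x + y)) * (b - a)"
    proof (intro mult_right_mono)
      have "x / (x + y) + lam / (x + y) \<le> 1"
        using x y lam by (simp flip: add_divide_distrib)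
      then show "x / (x + y) * 1 \<le> 1 - lam / (x + y)" by simp
    qed (use ab in simp)
    finally show ?thesis unfolding sets_eq .
  next
    case False
    define u where "u = q - y"
    define f where "f t = ((x - u) / (x + y) + 1 / (x + y) * \<gamma> t) - indicator {t. q \<le> \<gamma> t} t" for t
    have f_abs: "f absolutely_integrable_on {a..b}"
      unfolding f_def using superlevel_indicator(1)[OF \<gamma>a] \<gamma>a
      by (intro set_integral_diff set_integral_add set_integrable_mult_right absolutely_integrable_on_const) auto
    have f_int: "integral {c..d} f = (x - u) / (x + y) * (d - c) + integral {c..d} \<gamma> / (x + y)
         - measure lebesgue {t \<in> {c..d}. q \<le> \<gamma> t}"
      if "a \<le> c" "c < d" "d \<le> b" for c d
    proof -
      have c: "\<gamma> absolutely_integrable_on {c..d}" using absolutely_integrable_on_subinterval[OF \<gamma>a] that by auto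
      then have "(f has_integral (d - c) *\<^sub>R ((x - u) / (x + y)) + 1 / (x + y) * integral {c..d} \<gamma>
         - integral {c..d} (indicator {t. q \<le> \<gamma> t})) {c..d}"
        unfolding f_def using that has_integral_const_real[of "(x - u) / (x + y)" c d] superlevel_indicator(1)[OF c, of q]
        by (intro has_integral_diff has_integral_add has_integral_mult_right integrable_integral)
          (auto intro!: absolutely_integrable_imp_integrable)
      then show ?thesis using superlevel_indicator(2)[OF c, of q] by (auto dest!: integral_unique simp: algebra_simps)
    qed
    have h_int: "integral {c..d} (\<lambda>t. u - \<gamma> t) = u * (d - c) - integral {c..d} \<gamma>"
      if "a \<le> c" "c < d" "d \<le> b" for c d
    proof -
      have "\<gamma> integrable_on {c..d}"
        using absolutely_integrable_on_subinterval[OF \<gamma>a] that absolutely_integrable_imp_integrable by auto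
      then show ?thesis using that by (subst Henstock_Kurzweil_Integration.integral_diff) auto
    qed
    have "0 \<le> integral {a..b} f"
    \<comment> \<open>The sign is opposite to that in \<open>level_induct\<close>, because the
      average now lies above the level at which blocks are selected.\<close>
    proof (rule sunrise_principle[where h = "\<lambda>t. u - \<gamma> t"])
      show "a \<le> b" using ab by simp
      show "(\<lambda>t. u - \<gamma> t) absolutely_integrable_on {a..b}"
        using \<gamma>a by (intro set_integral_diff absolutely_integrable_on_const) auto
      show "f absolutely_integrable_on {a..b}" by (rule f_abs)
      have "(u - k) * (b - a) \<le> 0" using False ab by (intro mult_nonpos_nonneg) (auto simp: u_def)
      then show "integral {a..b} (\<lambda>t. u - \<gamma> t) \<le> 0"
        using h_int[of a b] ab avgk by (simp add: algebra_simps)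
      show "0 \<le> f t" if "u - \<gamma> t \<le> 0" for t
      proof -
        have e: "(x - u) / (x + y) + 1 / (x + y) * \<gamma> t = (x - u + \<gamma> t) / (x + y)"
          by (simp add: add_divide_distrib)
        show ?thesis
        proof (cases "q \<le> \<gamma> t")
          case True
          then have "\<gamma> t = q" using \<gamma>q[of t] by simp
          then show ?thesis using x y unfolding f_def e by (simp add: u_def)
        next
          case False
          then show ?thesis using that x y unfolding f_def e by simp
        qed
      qed
      fix c d assume cd: "a \<le> c" "c < d" "d \<le> b" "integral {c..d} (\<lambda>t. u - \<gamma> t) = 0"
      then have av: "integral {c..d} \<gamma> = u * (d - c)" using h_int by simp
      have "log_A_inf_on C c d \<gamma>" using log_A_inf_on_subinterval[OF G] cd by auto
      then have "measure lebesgue {t \<in> {c..d}. q \<le> \<gamma> t} \<le> x / (x + y) * (d - c)"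
        using exponential_tail[of c d \<gamma> 0 u] cd av by (simp add: u_def)
      moreover have "(x - u) / (x + y) * (d - c) + u * (d - c) / (x + y) = x / (x + y) * (d - c)"
        by (simp add: diff_divide_distrib left_diff_distrib)
      ultimately show "0 \<le> integral {c..d} f" unfolding f_int[OF cd(1-3)] av by linarith
    qed
    then have "measure lebesgue {t \<in> {a..b}. q \<le> \<gamma> t} \<le> (x - u) / (x + y) * (b - a) + k * (b - a) / (x + y)"
      unfolding f_int[OF order_refl ab order_refl] avgk by linarith
    also have "\<dots> = (x - u + k) / (x + y) * (b - a)" by (simp add: add_divide_distrib distrib_right)
    also have "\<dots> \<le> (1 - lam / (x + y)) * (b - a)"
    proof (intro mult_right_mono)
      have "(x - u + k) / (x + y) + lam / (x + y) = (x - u + k + lam) / (x + y)"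
        by (simp only: add_divide_distrib)
      also have "\<dots> \<le> 1" using x y km by (simp add: u_def q_def)
      finally show "(x - u + k) / (x + y) \<le> 1 - lam / (x + y)" by simp
    qed (use ab in simp)
    finally show ?thesis unfolding sets_eq .
  qed
qed

end

text \<open>For C = 1 Jensen's inequality has no slack: e^\<phi> minus its tangent at m has integral
  at most 0, yet it is nonnegative and at least a positive constant on the superlevel set.\<close>

lemma constant_tail:
  assumes A: "log_A_inf_on 1 a b \<phi>" and ab: "a < b" and lam: "0 < lam"
    and avg: "integral {a..b} \<phi> = m * (b - a)"
  shows "measure lebesgue {t \<in> {a..b}. m + lam \<le> \<phi> t} \<le> 0"
proof -
  have I: "\<phi> absolutely_integrable_on {a..b}" and e: "(\<lambda>t. exp (\<phi> t)) absolutely_integrable_on {a..b}"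
    using A by (auto simp: log_A_inf_on_def)
  define c where "c = exp m * (exp lam - (1 + lam))"
  have "0 < lam\<^sup>2 / 2" using lam by simp
  then have "0 < exp lam - (1 + lam)" using exp_lower_Taylor_quadratic[of lam] lam by linarith
  then have c: "0 < c" by (simp add: c_def)
  have pt: "c * indicator {t. m + lam \<le> \<phi> t} t \<le> exp (\<phi> t) - (exp m * (1 - m) + exp m * \<phi> t)" for t
  proof (cases "m + lam \<le> \<phi> t")
    case True
    define s where "s = \<phi> t - m - lam"
    have s: "0 \<le> s" using True by (simp add: s_def)
    have "exp (\<phi> t) = exp m * exp lam * exp s" by (simp add: s_def flip: exp_add)
    moreover have "exp m * exp lam * (1 + s) \<le> exp m * exp lam * exp s"
      using exp_ge_add_one_self by (intro mult_left_mono) auto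
    moreover have "exp m * 1 * s \<le> exp m * exp lam * s" using lam s by (intro mult_mono) auto
    ultimately show ?thesis using True by (simp add: c_def s_def algebra_simps)
  next
    case False
    have "exp m * (1 + (\<phi> t - m)) \<le> exp m * exp (\<phi> t - m)"
      using exp_ge_add_one_self by (intro mult_left_mono) auto
    then show ?thesis using False by (simp add: algebra_simps flip: exp_add)
  qed
  have 1: "((\<lambda>t. exp (\<phi> t) - (exp m * (1 - m) + exp m * \<phi> t)) has_integral
     (integral {a..b} (\<lambda>t. exp (\<phi> t)) - ((b - a) *\<^sub>R (exp m * (1 - m)) + exp m * integral {a..b} \<phi>))) {a..b}"
    using I e ab has_integral_const_real[of "exp m * (1 - m)" a b]
    by (intro has_integral_diff has_integral_add has_integral_mult_right integrable_integral)
      (auto intro!: absolutely_integrable_imp_integrable)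
  have 2: "((\<lambda>t. c * indicator {t. m + lam \<le> \<phi> t} t) has_integral
      c * integral {a..b} (indicator {t. m + lam \<le> \<phi> t})) {a..b}"
    using superlevel_indicator(1)[OF I]
    by (intro has_integral_mult_right integrable_integral absolutely_integrable_imp_integrable)
  have "c * integral {a..b} (indicator {t. m + lam \<le> \<phi> t})
     \<le> integral {a..b} (\<lambda>t. exp (\<phi> t)) - ((b - a) *\<^sub>R (exp m * (1 - m)) + exp m * integral {a..b} \<phi>)"
    by (rule has_integral_le[OF 2 1 pt])
  also have "integral {a..b} (\<lambda>t. exp (\<phi> t)) \<le> 1 * (b - a) * exp (integral {a..b} \<phi> / (b - a))"
    using A ab by (simp add: log_A_inf_on_def)
  also have "integral {a..b} \<phi> / (b - a) = m" using ab avg by simp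
  finally have "c * measure lebesgue {t \<in> {a..b}. m + lam \<le> \<phi> t} \<le> 0"
    using superlevel_indicator(2)[OF I] ab avg by (simp add: algebra_simps)
  then show ?thesis using c by (simp add: mult_le_0_iff)
qed

section \<open>Transfer between arbitrary and compact intervals\<close>

lemma bounded_interval_cases:
  fixes J :: "real set"
  assumes J: "nondegenerate_interval J" "bounded J"
  obtains a b where "a < b" "{a<..<b} \<subseteq> J" "J \<subseteq> {a..b}"
proof -
  have int: "is_interval J" and "interior J \<noteq> {}" using J(1) by (auto simp: nondegenerate_interval_def)
  then obtain z e where "0 < e" "cball z e \<subseteq> J" by (auto simp: mem_interior_cball)
  then have z: "z \<in> J" "z + e \<in> J" "0 < e" by (auto simp: subset_iff dist_real_def)
  have bdd: "bdd_above J" "bdd_below J"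
    using J(2) by (auto intro: bounded_imp_bdd_above bounded_imp_bdd_below)
  have "Inf J \<le> z" "z + e \<le> Sup J" using z bdd by (auto intro: cInf_lower cSup_upper)
  then have "Inf J < Sup J" using z by simp
  moreover have "{Inf J<..<Sup J} \<subseteq> J"
  proof
    fix t assume t: "t \<in> {Inf J<..<Sup J}"
    obtain p where "p \<in> J" "p < t" using t cInf_less_iff[of J t] bdd z by auto
    moreover obtain q where "q \<in> J" "t < q" using t less_cSup_iff[of J t] bdd z by auto
    ultimately show "t \<in> J" using mem_is_interval_1_I[OF int, of p q t] by auto
  qed
  moreover have "J \<subseteq> {Inf J..Sup J}" using bdd by (auto intro: cInf_lower cSup_upper)
  ultimately show ?thesis using that by blast
qed

lemma interval_integral_endpoints:
  fixes f :: "real \<Rightarrow> real"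
  assumes "{a<..<b} \<subseteq> J" "J \<subseteq> {a..b}"
  shows "set_integrable lebesgue J f \<longleftrightarrow> f absolutely_integrable_on {a..b}"
    and "f absolutely_integrable_on {a..b} \<Longrightarrow> (LINT t:J|lebesgue. f t) = integral {a..b} f"
proof -
  have d: "(J - {a..b}) \<union> ({a..b} - J) \<subseteq> {a, b}"
    using assms by (auto simp: subset_iff) (metis less_eq_real_def)
  show "set_integrable lebesgue J f \<longleftrightarrow> f absolutely_integrable_on {a..b}"
    by (rule set_integrable_discrete_difference[OF _ d]) auto
  assume "f absolutely_integrable_on {a..b}"
  moreover have "(LINT t:J|lebesgue. f t) = (LINT t:{a..b}|lebesgue. f t)"
    by (rule set_integral_discrete_difference[OF _ d]) auto
  ultimately show "(LINT t:J|lebesgue. f t) = integral {a..b} f"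
    by (simp add: set_lebesgue_integral_eq_integral(2))
qed

lemma interval_measurable_endpoints:
  fixes J :: "real set"
  assumes "a < b" "{a<..<b} \<subseteq> J" "J \<subseteq> {a..b}"
  shows "J \<in> lmeasurable" "measure lebesgue J = b - a"
proof -
  have "J = {a<..<b} \<union> (J \<inter> {a, b})" using assms by (auto simp: less_eq_real_def)
  then have "J \<in> sets borel"
    by (metis sets.Un borel_open open_greaterThanLessThan finite_Int finite.emptyI finite.insertI finite_imp_closed borel_closed)
  then have "J \<in> sets lebesgue" by (simp add: sets_completionI_sets)
  then show J: "J \<in> lmeasurable"
    using assms(3) bounded_subset[OF bounded_closed_interval] by (intro bounded_set_imp_lmeasurable) auto
  have "measure lebesgue {a<..<b} \<le> measure lebesgue J"
    by (rule measure_mono_fmeasurable) (use assms J in \<open>auto simp: fmeasurable_def\<close>)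
  moreover have "measure lebesgue J \<le> measure lebesgue {a..b}"
    by (rule measure_mono_fmeasurable) (use assms J in \<open>auto simp: fmeasurable_def\<close>)
  ultimately show "measure lebesgue J = b - a" using assms(1) by simp
qed

lemma average_interval:
  assumes "a < b" "{a<..<b} \<subseteq> J" "J \<subseteq> {a..b}" "f absolutely_integrable_on {a..b}"
  shows "average J f = integral {a..b} f / (b - a)"
  using assms by (simp add: average_def interval_integral_endpoints(2) interval_measurable_endpoints(2))

lemma open_subinterval:
  assumes "c < d" "{c<..<d} \<subseteq> Q"
  shows "{c<..<d} \<in> subintervals Q"
  using assms by (simp add: subintervals_def nondegenerate_interval_def is_interval_oo interior_open)

text \<open>The end points may lie outside Q, so the characteristic is tested on open intervals; two
  points do not affect the integrals.\<close>

lemma A_inf_le_imp_log_A_inf_on: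
  assumes w: "(\<lambda>t. exp (\<phi> t)) \<in> A_inf_le C Q"
    and ab: "a < b" "{a<..<b} \<subseteq> Q"
  shows "log_A_inf_on C a b \<phi>"
proof -
  have abs: "(\<lambda>t. exp (\<phi> t)) absolutely_integrable_on {c..d}" "\<phi> absolutely_integrable_on {c..d}"
    if "{c<..<d} \<in> subintervals Q" for c d
    using w that interval_integral_endpoints(1)[of c d "{c<..<d}"]
    by (force simp: A_inf_le_def A_inf_def)+
  show ?thesis
    unfolding log_A_inf_on_def
  proof (intro conjI allI impI)
    show "\<phi> absolutely_integrable_on {a..b}" "(\<lambda>t. exp (\<phi> t)) absolutely_integrable_on {a..b}"
      using abs[OF open_subinterval[OF ab]] by auto
    fix c d assume cd: "a \<le> c" "c < d" "d \<le> b"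
    then have "{c<..<d} \<subseteq> Q" using ab by force
    then have S: "{c<..<d} \<in> subintervals Q" using open_subinterval cd by simp
    have "ereal (average {c<..<d} (\<lambda>t. exp (\<phi> t)) * exp (- average {c<..<d} (\<lambda>t. ln (exp (\<phi> t)))))
        \<le> A_inf_char Q (\<lambda>t. exp (\<phi> t))"
      unfolding A_inf_char_def by (rule SUP_upper[OF S])
    also have "\<dots> \<le> ereal C" using w by (simp add: A_inf_le_def)
    finally have "average {c<..<d} (\<lambda>t. exp (\<phi> t)) * exp (- average {c<..<d} \<phi>) \<le> C" by simp
    then have "average {c<..<d} (\<lambda>t. exp (\<phi> t)) \<le> C * exp (average {c<..<d} \<phi>)"
      by (simp add: exp_minus field_simps)
    then show "integral {c..d} (\<lambda>t. exp (\<phi> t)) \<le> C * (d - c) * exp (integral {c..d} \<phi> / (d - c))"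
      using cd abs[OF S]
      by (simp add: average_interval[OF cd(2) order_refl] greaterThanLessThan_subseteq_atLeastAtMost_iff
          pos_divide_le_eq mult_ac)
  qed
qed

lemma A_inf_leI:
  assumes C: "\<And>c d. \<lbrakk>c < d; {c<..<d} \<subseteq> Q\<rbrakk> \<Longrightarrow> log_A_inf_on C c d \<phi>"
  shows "(\<lambda>t. exp (\<phi> t)) \<in> A_inf_le C Q"
proof -
  have J: "set_integrable lebesgue J \<phi> \<and> set_integrable lebesgue J (\<lambda>t. exp (\<phi> t))
      \<and> average J (\<lambda>t. exp (\<phi> t)) * exp (- average J \<phi>) \<le> C" if "J \<in> subintervals Q" for J
  proof -
    have "nondegenerate_interval J" "bounded J" and JQ: "J \<subseteq> Q" using that by (auto simp: subintervals_def)
    then obtain c d where cd: "c < d" "{c<..<d} \<subseteq> J" "J \<subseteq> {c..d}" using bounded_interval_cases by metis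
    then have L: "log_A_inf_on C c d \<phi>" using C JQ by auto
    then have abs: "\<phi> absolutely_integrable_on {c..d}" "(\<lambda>t. exp (\<phi> t)) absolutely_integrable_on {c..d}"
      by (auto simp: log_A_inf_on_def)
    have "integral {c..d} (\<lambda>t. exp (\<phi> t)) \<le> C * (d - c) * exp (integral {c..d} \<phi> / (d - c))"
      using L cd by (simp add: log_A_inf_on_def)
    then have "average J (\<lambda>t. exp (\<phi> t)) \<le> C * exp (average J \<phi>)"
      using cd abs by (simp add: average_interval[OF cd] pos_divide_le_eq mult_ac)
    then show ?thesis using abs interval_integral_endpoints(1)[OF cd(2,3)]
      by (simp add: exp_minus field_simps)
  qed
  have le: "A_inf_char Q (\<lambda>t. exp (\<phi> t)) \<le> ereal C"
    unfolding A_inf_char_def using J by (intro SUP_least) auto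
  also have "\<dots> < \<infinity>" by simp
  finally show ?thesis using le J by (simp add: A_inf_le_def A_inf_def)
qed

lemma log_A_inf_on_0:
  assumes "1 \<le> C"
  shows "log_A_inf_on C a b (\<lambda>_. 0)"
proof -
  have "(\<lambda>t. 1::real) absolutely_integrable_on {a..b}" by (rule absolutely_integrable_on_const) auto
  then show ?thesis using assms by (auto simp: log_A_inf_on_def mult_left_mono)
qed

section \<open>The extremal function\<close>

context tangent_pair begin

text \<open>The average over \<open>(0, s)\<close> decreases from \<open>y\<close> to \<open>0\<close> along the chord tangent to the upper
  boundary of the domain \<open>e\<^sup>p \<le> q \<le> C e\<^sup>p\<close> of averages, and for \<open>s \<ge> 1\<close> it follows that boundary.\<close>

definition extremal :: "real \<Rightarrow> real" where
  "extremal t = (if t \<le> x / (x + y) then y else if t \<le> 1 then - x else - x * (1 + ln t))"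

definition primitive :: "real \<Rightarrow> real" where
  "primitive t = (if t \<le> x / (x + y) then y * t else if t \<le> 1 then x - x * t else - x * ln t * t)"

text \<open>Up to t = 1 the averages satisfy the tangent equation q = C (1 + p), from then on q = C
  e^p with p = - x ln t; both are multiplied by t.\<close>

definition primitive_exp :: "real \<Rightarrow> real" where
  "primitive_exp t = (if t \<le> 1 then C * (t + primitive t) else C * exp (- x * ln t) * t)"

lemma jump_bounds: "0 < x / (x + y)" "x / (x + y) < 1"
  using x y by auto

lemma continuous_primitive: "continuous_on {0..} primitive"
  unfolding primitive_def
proof (rule continuous_on_cases_le[where h = "\<lambda>t. t"])
  show "continuous_on {t \<in> {0..}. x / (x + y) \<le> t} (\<lambda>t. if t \<le> 1 then x - x * t else - x * ln t * t)"
    using jump_bounds by (intro continuous_on_cases_le[where h = "\<lambda>t. t"] continuous_intros) auto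
  fix t assume t: "t = x / (x + y)"
  have "y * (x / (x + y)) = x - x * (x / (x + y))" using x y by (simp add: field_simps)
  then show "y * t = (if t \<le> 1 then x - x * t else - x * ln t * t)" unfolding t using jump_bounds by simp
qed (auto intro!: continuous_intros)

lemma continuous_primitive_exp: "continuous_on {0..} primitive_exp"
  unfolding primitive_exp_def
proof (rule continuous_on_cases_le[where h = "\<lambda>t. t"])
  show "continuous_on {t \<in> {0..}. t \<le> 1} (\<lambda>t. C * (t + primitive t))"
    by (intro continuous_intros continuous_on_subset[OF continuous_primitive]) auto
  show "continuous_on {t \<in> {0..}. 1 \<le> t} (\<lambda>t. C * exp (- x * ln t) * t)"
    by (intro continuous_intros) auto
  show "C * (t + primitive t) = C * exp (- x * ln t) * t" if "t = 1" for t
    using jump_bounds that by (simp add: primitive_def)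
qed (auto intro!: continuous_intros)

lemma primitive_deriv:
  assumes t: "0 < t" "t \<noteq> x / (x + y)" "t \<noteq> 1"
  shows "(primitive has_real_derivative extremal t) (at t)"
    and "(primitive_exp has_real_derivative exp (extremal t)) (at t)"
proof -
  consider "t < x / (x + y)" | "x / (x + y) < t" "t < 1" | "1 < t" using t by linarith
  then have "(primitive has_real_derivative extremal t) (at t) \<and> (primitive_exp has_real_derivative exp (extremal t)) (at t)"
  proof cases
    case 1
    have e: "extremal t = y" using 1 by (simp add: extremal_def)
    have "((\<lambda>t. y * t) has_real_derivative y) (at t)" by (auto intro!: derivative_eq_intros)
    then have p: "(primitive has_real_derivative y) (at t)"
      by (rule has_field_derivative_transform_within_open[of _ _ _ "{..<x / (x + y)}"]) (use 1 in \<open>auto simp: primitive_def\<close>)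
    then have "((\<lambda>t. C * (t + primitive t)) has_real_derivative exp y) (at t)"
      unfolding exp_y by (auto intro!: derivative_eq_intros)
    then have "(primitive_exp has_real_derivative exp y) (at t)"
      by (rule has_field_derivative_transform_within_open[of _ _ _ "{..<1}"]) (use 1 jump_bounds in \<open>auto simp: primitive_exp_def\<close>)
    with p e show ?thesis by simp
  next
    case 2
    have e: "extremal t = - x" using 2 by (simp add: extremal_def)
    have "((\<lambda>t. x - x * t) has_real_derivative - x) (at t)" by (auto intro!: derivative_eq_intros)
    then have p: "(primitive has_real_derivative - x) (at t)"
      by (rule has_field_derivative_transform_within_open[of _ _ _ "{x / (x + y)<..<1}"]) (use 2 in \<open>auto simp: primitive_def\<close>)
    then have "((\<lambda>t. C * (t + primitive t)) has_real_derivative exp (- x)) (at t)"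
      unfolding exp_x by (auto intro!: derivative_eq_intros)
    then have "(primitive_exp has_real_derivative exp (- x)) (at t)"
      by (rule has_field_derivative_transform_within_open[of _ _ _ "{..<1}"]) (use 2 in \<open>auto simp: primitive_exp_def\<close>)
    with p e show ?thesis by simp
  next
    case 3
    have e: "extremal t = - x * (1 + ln t)" using 3 jump_bounds by (simp add: extremal_def)
    have "((\<lambda>t. - x * ln t * t) has_real_derivative - x * (1 + ln t)) (at t)"
      using 3 by (auto intro!: derivative_eq_intros simp: algebra_simps)
    then have p: "(primitive has_real_derivative - x * (1 + ln t)) (at t)"
      by (rule has_field_derivative_transform_within_open[of _ _ _ "{1<..}"]) (use 3 jump_bounds in \<open>auto simp: primitive_def\<close>)
    have "exp (- x * (1 + ln t)) = exp (- x) * exp (- x * ln t)" by (simp add: algebra_simps flip: exp_add)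
    also have "\<dots> = C * (1 - x) * exp (- x * ln t)" by (simp only: exp_x)
    finally have "((\<lambda>t. C * exp (- x * ln t) * t) has_real_derivative exp (- x * (1 + ln t))) (at t)"
      using 3 by (auto intro!: derivative_eq_intros simp: algebra_simps)
    then have "(primitive_exp has_real_derivative exp (- x * (1 + ln t))) (at t)"
      by (rule has_field_derivative_transform_within_open[of _ _ _ "{1<..}"]) (use 3 in \<open>auto simp: primitive_exp_def\<close>)
    with p e show ?thesis by simp
  qed
  then show "(primitive has_real_derivative extremal t) (at t)"
    "(primitive_exp has_real_derivative exp (extremal t)) (at t)" by auto
qed

lemma extremal_has_integral:
  assumes cd: "0 \<le> c" "c \<le> d"
  shows "(extremal has_integral primitive d - primitive c) {c..d}"
    and "((\<lambda>t. exp (extremal t)) has_integral primitive_exp d - primitive_exp c) {c..d}"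
proof -
  show "(extremal has_integral primitive d - primitive c) {c..d}"
    by (rule fundamental_theorem_of_calculus_interior_strong[of "{x / (x + y), 1}"])
      (use cd in \<open>auto intro!: primitive_deriv(1) continuous_on_subset[OF continuous_primitive]
         simp flip: has_real_derivative_iff_has_vector_derivative\<close>)
  show "((\<lambda>t. exp (extremal t)) has_integral primitive_exp d - primitive_exp c) {c..d}"
    by (rule fundamental_theorem_of_calculus_interior_strong[of "{x / (x + y), 1}"])
      (use cd in \<open>auto intro!: primitive_deriv(2) continuous_on_subset[OF continuous_primitive_exp]
         simp flip: has_real_derivative_iff_has_vector_derivative\<close>)
qed

lemma extremal_absolutely_integrable:
  assumes cd: "0 \<le> c" "c \<le> d"
  shows "extremal absolutely_integrable_on {c..d}"
    and "(\<lambda>t. exp (extremal t)) absolutely_integrable_on {c..d}"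
proof -
  \<comment> \<open>A lower bound: \<open>extremal\<close> is at least - K on the interval, so that
    adding K gives a nonnegative function, for which integrability is absolute.\<close>
  define K where "K = x * (1 + ln (max 1 d))"
  have "0 \<le> ln (max 1 d)" by simp
  then have K: "0 \<le> K" "x \<le> K" using x by (auto simp: K_def)
  have "0 \<le> extremal t + K" if "t \<in> {c..d}" for t
  proof (cases "t \<le> 1")
    case False
    then have "x * (1 + ln t) \<le> K" unfolding K_def using that x by (intro mult_left_mono) auto
    then show ?thesis using False jump_bounds by (simp add: extremal_def)
  qed (use K y in \<open>auto simp: extremal_def\<close>)
  moreover have "(\<lambda>t. extremal t + K) integrable_on {c..d}"
    using extremal_has_integral(1)[OF cd] by (intro integrable_add) auto
  ultimately have "(\<lambda>t. extremal t + K) absolutely_integrable_on {c..d}"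
    by (intro nonnegative_absolutely_integrable_1) auto
  moreover have "(\<lambda>t. K) absolutely_integrable_on {c..d}" by (rule absolutely_integrable_on_const) auto
  ultimately have "(\<lambda>t. extremal t + K - K) absolutely_integrable_on {c..d}" by (rule set_integral_diff)
  then show "extremal absolutely_integrable_on {c..d}" by simp
  show "(\<lambda>t. exp (extremal t)) absolutely_integrable_on {c..d}"
    using extremal_has_integral(2)[OF cd] by (intro nonnegative_absolutely_integrable_1) auto
qed

lemma primitive_nonneg:
  assumes "0 \<le> c" "c \<le> 1"
  shows "0 \<le> primitive c"
  using assms x y by (auto simp: primitive_def mult_left_le)

lemma extremal_jensen:
  assumes cd: "0 \<le> c" "c < d"
  shows "primitive_exp d - primitive_exp c \<le> C * (d - c) * exp ((primitive d - primitive c) / (d - c))"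
proof -
  \<comment> \<open>The averages over \<open>(0, d)\<close> lie on the tangent to the upper boundary at \<open>v\<close>, those over
    \<open>(0, c)\<close> on or above it; hence the averages over \<open>(c, d)\<close> lie on or below it.\<close>
  define v where "v = (if d \<le> 1 then 0 else - x * ln d)"
  define A where "A = (primitive d - primitive c) / (d - c)"
  have A: "primitive d - primitive c = A * (d - c)" using cd by (simp add: A_def)
  have v0: "v \<le> 0" using x by (auto simp: v_def)
  have d0: "primitive_exp d = C * exp v * ((1 - v) * d + primitive d)"
    using jump_bounds by (auto simp: v_def primitive_exp_def primitive_def algebra_simps)
  \<comment> \<open>The tangent at v \<le> 0 lies below the line C (1 + p) for p \<ge> 0, which
    carries the averages with c \<le> 1, and below the curve C e^p, which carries the
    others.\<close>
  have c0: "C * exp v * ((1 - v) * c + primitive c) \<le> primitive_exp c"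
  proof (cases "c \<le> 1")
    case True
    have "exp v * (1 - v) \<le> exp v * exp (- v)"
      using exp_ge_add_one_self[of "- v"] by (intro mult_left_mono) auto
    then have "exp v * (1 - v) \<le> 1" by (simp flip: exp_add)
    then have "exp v * (1 - v) * c \<le> 1 * c" using cd by (intro mult_right_mono)
    moreover have "exp v * primitive c \<le> 1 * primitive c" using v0 primitive_nonneg cd True by (intro mult_right_mono) auto
    ultimately have "C * (exp v * (1 - v) * c + exp v * primitive c) \<le> C * (c + primitive c)"
      using C_pos by (intro mult_left_mono) auto
    then show ?thesis using True by (simp add: primitive_exp_def algebra_simps)
  next
    case False
    define w where "w = - x * ln c"
    have "exp v * (1 + (w - v)) \<le> exp v * exp (w - v)"
      using exp_ge_add_one_self by (intro mult_left_mono) auto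
    also have "\<dots> = exp w" by (simp flip: exp_add)
    finally have "C * c * (exp v * (1 + (w - v))) \<le> C * c * exp w"
      using C_pos cd by (intro mult_left_mono) auto
    moreover have "primitive c = w * c" "primitive_exp c = C * exp w * c"
      using False jump_bounds by (auto simp: primitive_def primitive_exp_def w_def)
    ultimately show ?thesis by (simp add: algebra_simps)
  qed
  have "primitive_exp d - primitive_exp c \<le> C * exp v * ((1 - v) * (d - c) + (primitive d - primitive c))"
    using d0 c0 by (simp add: algebra_simps)
  also have "\<dots> = C * (d - c) * (exp v * (1 + (A - v)))" unfolding A by (simp add: algebra_simps)
  also have "\<dots> \<le> C * (d - c) * (exp v * exp (A - v))"
    using C_pos cd exp_ge_add_one_self by (intro mult_left_mono) auto
  also have "exp v * exp (A - v) = exp A" by (simp flip: exp_add)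
  finally show ?thesis by (simp add: A_def)
qed

lemma extremal_log_A_inf_on:
  assumes "0 \<le> a" "a \<le> b"
  shows "log_A_inf_on C a b extremal"
  unfolding log_A_inf_on_def
proof (intro conjI allI impI)
  show "extremal absolutely_integrable_on {a..b}" "(\<lambda>t. exp (extremal t)) absolutely_integrable_on {a..b}"
    using extremal_absolutely_integrable assms by auto
  fix c d assume cd: "a \<le> c" "c < d" "d \<le> b"
  then have "integral {c..d} (\<lambda>t. exp (extremal t)) = primitive_exp d - primitive_exp c"
     "integral {c..d} extremal = primitive d - primitive c"
    using extremal_has_integral[of c d] assms by (auto intro!: integral_unique)
  then show "integral {c..d} (\<lambda>t. exp (extremal t)) \<le> C * (d - c) * exp (integral {c..d} extremal / (d - c))"
    using extremal_jensen[of c d] assms cd by simp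
qed

lemma extremal_in_A_inf_le: "(\<lambda>t. exp (extremal t)) \<in> A_inf_le C {0<..}"
proof (rule A_inf_leI)
  fix c d :: real assume cd: "c < d" "{c<..<d} \<subseteq> {0<..}"
  have "0 \<le> c"
  proof (rule ccontr)
    assume "\<not> 0 \<le> c"
    then have "min 0 d > c" using cd by auto
    then obtain z where "c < z" "z < min 0 d" using dense by blast
    then show False using cd(2) by (auto simp: subset_iff)
  qed
  then show "log_A_inf_on C c d extremal" using extremal_log_A_inf_on cd by auto
qed

text \<open>The condition on \<open>primitive s\<close> says that the average over (0, s) is y -
  lam. The set in question is therefore where the top value y is taken, namely up to x / (x +
  y).\<close>

lemma extremal_tail:
  assumes s: "x / (x + y) \<le> s" and lam: "primitive s = (y - lam) * s"
  shows "measure lebesgue {t \<in> {0<..<s}. extremal t - average {0<..<s} extremal \<ge> lam}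
    / measure lebesgue {0<..<s} = x / (x + y) / s"
proof -
  have s0: "0 < s" using s jump_bounds by linarith
  have "integral {0..s} extremal = primitive s - primitive 0"
    using extremal_has_integral(1)[of 0 s] s0 by (auto intro!: integral_unique)
  also have "primitive 0 = 0" using jump_bounds by (simp add: primitive_def)
  finally have "average {0<..<s} extremal = y - lam"
    using average_interval[of 0 s "{0<..<s}" extremal] s0 extremal_absolutely_integrable(1)[of 0 s] lam
    by (simp add: subset_iff)
  moreover have "y \<le> extremal t \<longleftrightarrow> t \<le> x / (x + y)" for t
  proof (cases "t \<le> 1")
    case False
    then have "0 < x * (1 + ln t)" using x by (intro mult_pos_pos) (auto simp: add_pos_pos)
    then show ?thesis using False jump_bounds y by (auto simp: extremal_def)
  qed (use x y in \<open>auto simp: extremal_def\<close>)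
  ultimately have eq: "{t \<in> {0<..<s}. extremal t - average {0<..<s} extremal \<ge> lam}
      = {t \<in> {0<..<s}. t \<le> x / (x + y)}" by auto
  have "measure lebesgue {t \<in> {0<..<s}. t \<le> x / (x + y)} = x / (x + y) - 0"
    by (rule interval_measurable_endpoints) (use s jump_bounds in auto)
  then show ?thesis unfolding eq using s0 by simp
qed

lemma extremal_attains:
  assumes lam: "0 < lam"
  shows "\<exists>s>0. measure lebesgue {t \<in> {0<..<s}. extremal t - average {0<..<s} extremal \<ge> lam}
    / measure lebesgue {0<..<s} =
      (if lam \<le> y then 1 - lam / (x + y) else x * exp (y / x) / (x + y) * exp (- lam / x))"
proof (cases "lam \<le> y")
  case True
  \<comment> \<open>On the middle branch of \<open>primitive\<close> the condition reads x - x s =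
    (y - lam) s, solved by s = x / D.\<close>
  define D where "D = x + y - lam"
  have D: "x \<le> D" "D < x + y" "0 < D" using True lam x by (auto simp: D_def)
  have s: "x / (x + y) < x / D" "x / D \<le> 1"
    using D x y by (auto intro!: divide_strict_left_mono mult_pos_pos)
  then have "primitive (x / D) = x - x * (x / D)" by (simp add: primitive_def)
  also have "\<dots> = (y - lam) * (x / D)" using D(3) by (simp add: field_simps) (simp add: D_def algebra_simps)
  finally have "measure lebesgue {t \<in> {0<..<x / D}. extremal t - average {0<..<x / D} extremal \<ge> lam}
    / measure lebesgue {0<..<x / D} = x / (x + y) / (x / D)"
    by (rule extremal_tail[OF less_imp_le[OF s(1)]])
  also have "\<dots> = D / (x + y)" using x by simp
  also have "\<dots> = 1 - lam / (x + y)" using x y by (simp add: D_def diff_divide_distrib)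
  finally show ?thesis using True D(3) x(1) divide_pos_pos[of x D] unfolding if_P[OF True] by blast
next
  case False
  \<comment> \<open>On the last branch of \<open>primitive\<close> the condition reads - x ln s = y
    - lam.\<close>
  define s where "s = exp ((lam - y) / x)"
  have s: "1 < s" using False x by (simp add: s_def)
  have "primitive s = - x * ln s * s" using s jump_bounds by (simp add: primitive_def)
  also have "- x * ln s = y - lam" using x by (simp add: s_def)
  finally have "measure lebesgue {t \<in> {0<..<s}. extremal t - average {0<..<s} extremal \<ge> lam}
    / measure lebesgue {0<..<s} = x / (x + y) / s"
    by (rule extremal_tail[rotated]) (use s jump_bounds in linarith)
  also have "\<dots> = x / (x + y) * inverse s" by (simp only: divide_inverse)
  also have "inverse s = exp (y / x) * exp (- lam / x)"
    unfolding s_def by (simp add: diff_divide_distrib flip: exp_add exp_minus)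
  also have "x / (x + y) * (exp (y / x) * exp (- lam / x)) = x * exp (y / x) / (x + y) * exp (- lam / x)"
    by simp
  finally show ?thesis using s less_trans[OF zero_less_one s] unfolding if_not_P[OF False] by blast
qed

end

section \<open>Validity and sharpness of the bound\<close>

lemma tangent_pair_xi:
  assumes "1 < C"
  shows "tangent_pair C (xi_plus C) (- xi_minus C)"
proof
  have p: "0 \<le> xi_plus C \<and> xi_plus C < 1 \<and> exp (- xi_plus C) = C * (1 - xi_plus C)"
    unfolding xi_plus_def by (rule theI') (use xi_plus_ex1 assms in auto)
  have m: "xi_minus C \<le> 0 \<and> exp (- xi_minus C) = C * (1 - xi_minus C)"
    unfolding xi_minus_def by (rule theI') (use xi_minus_ex1 assms in auto)
  have "xi_plus C \<noteq> 0" "xi_minus C \<noteq> 0" using p m assms by auto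
  then show "0 < xi_plus C" "0 < - xi_minus C" using p m by auto
  show "xi_plus C < 1" "exp (- xi_plus C) = C * (1 - xi_plus C)"
    "exp (- xi_minus C) = C * (1 + - xi_minus C)" using p m by auto
qed

lemma tail_bound_valid:
  assumes C: "1 \<le> C" and w: "(\<lambda>t. exp (\<phi> t)) \<in> A_inf_le C Q" and J: "J \<in> subintervals Q"
  shows "measure lebesgue {t \<in> J. \<phi> t - average J \<phi> \<ge> lam} / measure lebesgue J \<le> tail_bound C lam"
proof -
  have "nondegenerate_interval J" "bounded J" and JQ: "J \<subseteq> Q" using J by (auto simp: subintervals_def)
  then obtain a b where ab: "a < b" "{a<..<b} \<subseteq> J" "J \<subseteq> {a..b}" using bounded_interval_cases by metis
  have A: "log_A_inf_on C a b \<phi>" using A_inf_le_imp_log_A_inf_on[OF w ab(1)] ab JQ by auto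
  have abs: "\<phi> absolutely_integrable_on {a..b}" using A by (simp add: log_A_inf_on_def)
  define m where "m = average J \<phi>"
  have avg: "integral {a..b} \<phi> = m * (b - a)" using average_interval[OF ab abs] ab by (simp add: m_def)
  note mJ = interval_measurable_endpoints[OF ab]
  define S where "S = {t \<in> {a..b}. m + lam \<le> \<phi> t}"
  have S: "S \<in> lmeasurable" unfolding S_def by (rule superlevel_indicator(3)[OF abs])
  have eq: "{t \<in> J. \<phi> t - m \<ge> lam} = S \<inter> J" using ab by (auto simp: S_def)
  have le: "measure lebesgue {t \<in> J. \<phi> t - m \<ge> lam} \<le> measure lebesgue S"
    unfolding eq using S mJ by (intro measure_mono_fmeasurable) auto
  have le1: "measure lebesgue {t \<in> J. \<phi> t - m \<ge> lam} \<le> b - a"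
    unfolding eq mJ(2)[symmetric] using S mJ by (intro measure_mono_fmeasurable) auto
  have "measure lebesgue {t \<in> J. \<phi> t - m \<ge> lam} \<le> tail_bound C lam * (b - a)"
  proof (cases "lam \<le> 0")
    case True
    then show ?thesis using le1 by (simp add: tail_bound_def)
  next
    case lam: False
    show ?thesis
    proof (cases "C = 1")
      case True
      have "measure lebesgue S \<le> 0"
        unfolding S_def by (rule constant_tail[OF _ ab(1) _ avg]) (use A True lam in auto)
      then show ?thesis using le lam True by (simp add: tail_bound_def)
    next
      case False
      then interpret tangent_pair C "xi_plus C" "- xi_minus C" using C by (intro tangent_pair_xi) simp
      show ?thesis
      proof (cases "lam \<le> - xi_minus C")
        case True
        then show ?thesis
          using linear_tail[OF A ab(1) True avg] le lam \<open>C \<noteq> 1\<close> by (simp add: tail_bound_def S_def)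
      next
        case big: False
        have "measure lebesgue S \<le> xi_plus C / (xi_plus C - xi_minus C)
            * exp (- (lam + xi_minus C) / xi_plus C) * (b - a)"
          \<comment> \<open>Since y is \<open>- xi_minus C\<close>, the excess L = lam - y is
            \<open>lam + xi_minus C\<close>.\<close>
          using exponential_tail[OF A ab(1) _ avg, of "lam + xi_minus C"] big by (simp add: S_def)
        also have "exp (- (lam + xi_minus C) / xi_plus C)
            = exp (- xi_minus C / xi_plus C) * exp (- lam / xi_plus C)"
          by (simp add: add_divide_distrib diff_divide_distrib flip: exp_add)
        finally show ?thesis using le lam big \<open>C \<noteq> 1\<close> by (simp add: tail_bound_def)
      qed
    qed
  qed
  then show ?thesis using mJ(2) ab(1) by (simp add: m_def pos_divide_le_eq)
qed

text \<open>Equality at every lam rules out any smaller constant. If lam \<le> 0 or C = 1, the zero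
  function already gives the value 1 or 0; otherwise an initial interval of the half line
  serves.\<close>

lemma tail_bound_attained:
  assumes C: "1 \<le> C"
  shows "\<exists>Q \<phi> J. nondegenerate_interval Q \<and> (\<lambda>t. exp (\<phi> t)) \<in> A_inf_le C Q \<and> J \<in> subintervals Q \<and>
    measure lebesgue {t \<in> J. \<phi> t - average J \<phi> \<ge> lam} / measure lebesgue J = tail_bound C lam"
proof (cases "lam \<le> 0 \<or> C = 1")
  case True
  have J: "{0<..<1} \<in> subintervals {0<..<1::real}" by (rule open_subinterval) auto
  have "(\<lambda>t. exp ((\<lambda>_. 0) t)) \<in> A_inf_le C {0<..<1}" by (rule A_inf_leI) (rule log_A_inf_on_0[OF C])
  moreover have eq: "{t \<in> {0<..<1::real}. 0 - average {0<..<1} (\<lambda>_. 0) \<ge> lam} = (if lam \<le> 0 then {0<..<1} else {})"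
    by (auto simp: average_def)
  have "measure lebesgue {t \<in> {0<..<1::real}. 0 - average {0<..<1} (\<lambda>_. 0) \<ge> lam}
      / measure lebesgue {0<..<1::real} = tail_bound C lam"
    unfolding eq using True by (cases "lam \<le> 0") (auto simp: tail_bound_def)
  moreover have "nondegenerate_interval {0<..<1::real}" using J by (simp add: subintervals_def)
  ultimately show ?thesis using J by (intro exI[of _ "{0<..<1}"] exI[of _ "\<lambda>_. 0"] conjI)
next
  case False
  then interpret tangent_pair C "xi_plus C" "- xi_minus C" using C by (intro tangent_pair_xi) simp
  obtain s where s: "0 < s" and eq: "measure lebesgue {t \<in> {0<..<s}. extremal t - average {0<..<s} extremal \<ge> lam}
    / measure lebesgue {0<..<s} = tail_bound C lam"
    using extremal_attains[of lam] False by (auto simp: tail_bound_def)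
  have "{0<..<s} \<in> subintervals {0<..}" using s by (intro open_subinterval) auto
  moreover have "nondegenerate_interval {0::real<..}"
    by (simp add: nondegenerate_interval_def is_interval_1 interior_open)
  ultimately show ?thesis using eq extremal_in_A_inf_le by blast
qed

theorem theorem1p9:
  fixes C :: real
  assumes "1 \<le> C"
  shows "(\<forall>Q (\<phi> :: real \<Rightarrow> real) lam J.
            nondegenerate_interval Q \<longrightarrow> (\<lambda>t. exp (\<phi> t)) \<in> A_inf_le C Q \<longrightarrow>
            J \<in> subintervals Q \<longrightarrow>
            measure lebesgue {t \<in> J. \<phi> t - average J \<phi> \<ge> lam} / measure lebesgue J
              \<le> tail_bound C lam)
       \<and> (\<forall>lam K. K < tail_bound C lam \<longrightarrow>
            \<not> (\<forall>Q (\<phi> :: real \<Rightarrow> real) J.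
                 nondegenerate_interval Q \<longrightarrow> (\<lambda>t. exp (\<phi> t)) \<in> A_inf_le C Q \<longrightarrow>
                 J \<in> subintervals Q \<longrightarrow>
                 measure lebesgue {t \<in> J. \<phi> t - average J \<phi> \<ge> lam} / measure lebesgue J
                   \<le> K))"
proof (intro conjI allI impI notI)
  fix Q \<phi> lam J
  assume "(\<lambda>t. exp (\<phi> t)) \<in> A_inf_le C Q" "J \<in> subintervals Q"
  then show "measure lebesgue {t \<in> J. \<phi> t - average J \<phi> \<ge> lam} / measure lebesgue J \<le> tail_bound C lam"
    by (rule tail_bound_valid[OF assms])
next
  fix lam K
  assume K: "K < tail_bound C lam"
    and le: "\<forall>Q (\<phi> :: real \<Rightarrow> real) J.
                 nondegenerate_interval Q \<longrightarrow> (\<lambda>t. exp (\<phi> t)) \<in> A_inf_le C Q \<longrightarrow>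
                 J \<in> subintervals Q \<longrightarrow>
                 measure lebesgue {t \<in> J. \<phi> t - average J \<phi> \<ge> lam} / measure lebesgue J \<le> K"
  obtain Q \<phi> J where "nondegenerate_interval Q" "(\<lambda>t. exp (\<phi> t)) \<in> A_inf_le C Q" "J \<in> subintervals Q"
    "measure lebesgue {t \<in> J. \<phi> t - average J \<phi> \<ge> lam} / measure lebesgue J = tail_bound C lam"
    using tail_bound_attained[OF assms] by blast
  with le K show False by (metis not_le)
qed

end
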